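(* Let $G \ne K_4$ be a connected, claw-free, cubic graph of order $n$. Then $F_t(G) \le \frac{1}{2}n$, with equality if and only if $G \in \mathcal{N}_{\rm cubic}$ or $G$ is the prism $C_3 \,\Box\, K_2$.
   Context: Graphs are finite and simple. A graph is claw-free if it contains no induced subgraph isomorphic to $K_{1,3}$. Forcing process: given a graph $G$ and a set $S \subseteq V(G)$ of initially colored vertices, at each step, if a colored vertex has exactly one non-colored neighbor, that neighbor becomes colored. $S$ is a forcing set if iterating this process colors all of $V(G)$. A total forcing set is a forcing set $S$ such that $G[S]$ has no isolated vertex; $F_t(G)$ is the minimum size of a total forcing set. A diamond is $K_4$ minus one edge. For $k \ge 2$, the diamond-necklace $N_k$ is obtained from $k$ disjoint diamonds $D_1,\dots,D_k$, with $V(D_i)=\{a_i,b_i,c_i,d_i\}$ and $a_ib_i$ the missing edge of $D_i$, by adding the edges $a_ib_{i+1}$ for $i \in \{1,\dots,k-1\}$ and the edge $a_kb_1$. $\mathcal{N}_{\rm cubic} = \{N_k : k \ge 2\}$. The prism $C_3 \,\Box\, K_2$ is the Cartesian product of a triangle and an edge. *)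

theory Defs
  imports "Graph_Theory.Graph_Theory"
begin

text \<open>
  Finite simple graphs are the symmetric, loop-free digraphs without parallel arcs
  (locale \<^locale>\<open>graph\<close>), so each undirected edge is a pair of opposite arcs and the degree
  of a vertex is its out-degree.
\<close>

definition cubic :: "('a, 'b) pre_digraph \<Rightarrow> bool" where
  "cubic G \<longleftrightarrow> (\<forall>v \<in> verts G. out_degree G v = 3)"

definition claw_free :: "('a, 'b) pre_digraph \<Rightarrow> bool" where
  "claw_free G \<longleftrightarrow> \<not> (\<exists>H. induced_subgraph H G \<and> K\<^bsub>1,3\<^esub> H)"

definition force_step :: "('a, 'b) pre_digraph \<Rightarrow> 'a set \<Rightarrow> 'a set \<Rightarrow> bool" where
  "force_step G C C' \<longleftrightarrow>
     (\<exists>u \<in> C. \<exists>v. {w. u \<rightarrow>\<^bsub>G\<^esub> w \<and> w \<notin> C} = {v} \<and> C' = insert v C)"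

text \<open>
  Forces are performed one at a time. The order is irrelevant for whether all vertices end up
  colored: a force that is possible remains possible until its target is colored.
\<close>

definition forcing_set :: "('a, 'b) pre_digraph \<Rightarrow> 'a set \<Rightarrow> bool" where
  "forcing_set G S \<longleftrightarrow> S \<subseteq> verts G \<and> (force_step G)\<^sup>*\<^sup>* S (verts G)"

definition total_forcing_set :: "('a, 'b) pre_digraph \<Rightarrow> 'a set \<Rightarrow> bool" where
  "total_forcing_set G S \<longleftrightarrow> forcing_set G S \<and> (\<forall>v \<in> S. \<exists>w. v \<rightarrow>\<^bsub>G \<restriction> S\<^esub> w)"

text \<open>
  The minimum below exists for every finite graph without isolated vertices
  (see \<open>total_forcing_set_verts\<close>), in particular for every cubic graph.
\<close>

definition total_forcing_number :: "('a, 'b) pre_digraph \<Rightarrow> nat" where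
  "total_forcing_number G = (LEAST m. \<exists>S. total_forcing_set G S \<and> card S = m)"

lemma (in graph) total_forcing_set_verts:
  assumes "\<And>v. v \<in> verts G \<Longrightarrow> out_degree G v \<noteq> 0"
  shows "total_forcing_set G (verts G)"
  unfolding total_forcing_set_def forcing_set_def
proof (intro conjI ballI)
  fix v assume "v \<in> verts G"
  then have "out_degree G v \<noteq> 0" by (rule assms)
  then have "out_arcs G v \<noteq> {}" unfolding out_degree_def by (metis card.empty)
  then obtain e where "e \<in> out_arcs G v" by blast
  then have e: "e \<in> arcs G" "tail G e = v" by auto
  then have "v \<rightarrow>\<^bsub>G \<restriction> verts G\<^esub> head G e"
    by (auto simp: arcs_ends_conv intro!: image_eqI[of _ _ e])
  then show "\<exists>w. v \<rightarrow>\<^bsub>G \<restriction> verts G\<^esub> w" ..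
qed auto

datatype diamond_vertex = Da | Db | Dc | Dd

definition diamond_arcs :: "diamond_vertex rel" where
  "diamond_arcs = {(x, y). x \<noteq> y \<and> {x, y} \<noteq> {Da, Db}}"

text \<open>The vertex \<open>(i, x)\<close> is the copy of \<open>x\<close> in the \<open>i\<close>-th diamond, where \<open>i\<close> ranges over \<open>1, \<dots>, k\<close>.\<close>

definition necklace_links :: "nat \<Rightarrow> (nat \<times> diamond_vertex) rel" where
  "necklace_links k =
     {((i, Da), (i + 1, Db)) | i. i \<in> {1..k - 1}} \<union> {((k, Da), (1, Db))}"

definition diamond_necklace :: "nat \<Rightarrow> (nat \<times> diamond_vertex) pair_pre_digraph" where
  "diamond_necklace k =
     \<lparr> pverts = {1..k} \<times> UNIV,
       parcs = {((i, x), (i, y)) | i x y. i \<in> {1..k} \<and> (x, y) \<in> diamond_arcs}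
         \<union> necklace_links k \<union> (necklace_links k)\<inverse> \<rparr>"

definition in_N_cubic :: "('a, 'b) pre_digraph \<Rightarrow> bool" where
  "in_N_cubic G \<longleftrightarrow> (\<exists>k \<ge> 2. digraph_iso G (with_proj (diamond_necklace k)))"

definition cartesian_product ::
    "'a pair_pre_digraph \<Rightarrow> 'b pair_pre_digraph \<Rightarrow> ('a \<times> 'b) pair_pre_digraph" where
  "cartesian_product G H =
     \<lparr> pverts = pverts G \<times> pverts H,
       parcs = {((u, x), (v, y)) | u x v y.
         (u = v \<and> u \<in> pverts G \<and> (x, y) \<in> parcs H) \<or>
         (x = y \<and> x \<in> pverts H \<and> (u, v) \<in> parcs G)} \<rparr>"

definition complete_on :: "'a set \<Rightarrow> 'a pair_pre_digraph" where
  "complete_on V = \<lparr> pverts = V, parcs = {(u, v) \<in> V \<times> V. u \<noteq> v} \<rparr>"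

definition prism :: "(nat \<times> nat) pair_pre_digraph" where
  "prism = cartesian_product (complete_on {0, 1, 2}) (complete_on {0, 1})"

lemma pair_graph_diamond_necklace:
  assumes "k \<ge> 2"
  shows "pair_graph (diamond_necklace k)"
proof -
  have "finite (UNIV :: diamond_vertex set)"
    by (rule finite_subset[of _ "{Da, Db, Dc, Dd}"]) (simp_all add: subset_iff, metis diamond_vertex.exhaust)
  then have fin: "finite (pverts (diamond_necklace k))"
    by (simp add: diamond_necklace_def)
  have sub: "parcs (diamond_necklace k) \<subseteq> pverts (diamond_necklace k) \<times> pverts (diamond_necklace k)"
    using assms by (auto simp: diamond_necklace_def necklace_links_def)
  have "finite (parcs (diamond_necklace k))"
    using fin by (intro finite_subset[OF sub]) auto
  moreover have "sym (parcs (diamond_necklace k))"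
    by (auto simp: diamond_necklace_def diamond_arcs_def insert_commute intro!: symI)
  moreover have "\<And>e. e \<in> parcs (diamond_necklace k) \<Longrightarrow> fst e \<noteq> snd e"
    by (auto simp: diamond_necklace_def diamond_arcs_def necklace_links_def)
  ultimately show ?thesis
    using fin sub by unfold_locales (auto simp: symmetric_def)
qed

lemma pair_graph_complete_on:
  assumes "finite V"
  shows "pair_graph (complete_on V)"
proof -
  have "finite {(u, v) \<in> V \<times> V. u \<noteq> v}"
    by (rule finite_subset[of _ "V \<times> V"]) (use assms in auto)
  with assms show ?thesis
    unfolding complete_on_def by unfold_locales (auto simp: symmetric_def sym_def)
qed

lemma pair_graph_cartesian_product:
  assumes "pair_graph G" and "pair_graph H"
  shows "pair_graph (cartesian_product G H)"
proof -
  interpret G: pair_graph G by fact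
  interpret H: pair_graph H by fact
  let ?P = "cartesian_product G H"
  have fin: "finite (pverts ?P)"
    using G.pair_finite_verts H.pair_finite_verts by (simp add: cartesian_product_def)
  have sub: "parcs ?P \<subseteq> pverts ?P \<times> pverts ?P"
    by (auto simp: cartesian_product_def dest: G.in_arcsD1 G.in_arcsD2 H.in_arcsD1 H.in_arcsD2)
  have "finite (parcs ?P)"
    using fin by (intro finite_subset[OF sub]) auto
  moreover have "sym (parcs ?P)"
    unfolding sym_def cartesian_product_def using G.arcs_symmetric H.arcs_symmetric by fastforce
  moreover have "fst e \<noteq> snd e" if "e \<in> parcs ?P" for e
    using that by (auto simp: cartesian_product_def dest: G.pair_no_loops H.pair_no_loops)
  ultimately show ?thesis
    using fin sub by unfold_locales (auto simp: symmetric_def)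
qed

lemma pair_graph_prism: "pair_graph prism"
  by (simp add: prism_def pair_graph_cartesian_product pair_graph_complete_on)

end

theory Submission
  imports Defs
begin

text \<open>
  A connected claw-free cubic graph other than \<open>K\<^sub>4\<close> splits into vertex-disjoint triangles and
  diamonds joined by edges that lie in no triangle. A total forcing set is built greedily: the
  invariant is that \<open>2|S| - |U|\<close> never increases, where \<open>U\<close> is the set colored so far. When a force
  enters a diamond at the end \<open>a\<close>, the two middle vertices are added to \<open>S\<close> and all four vertices
  become colored. When no force is left, a triangle \<open>{x, y, z}\<close> has been entered at \<open>x\<close> only; one
  adds \<open>y\<close> and \<open>z\<close> (two vertices, which color four), or, if the external edge at \<open>z\<close> leads to a
  diamond end \<open>a\<close> with middle vertex \<open>c\<close>, one adds \<open>z\<close>, \<open>a\<close> and \<open>c\<close> (three vertices, which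
  color six).

  It remains to start with \<open>2|S| < |U|\<close>. If there are both triangles and diamonds, start at a diamond
  next to a triangle vertex \<open>x\<close>, or at such a diamond together with the triangle \<open>{x, y, z}\<close>. A
  parity argument shows that the chain of diamonds leaving \<open>x\<close> must end at some further vertex; if
  it returns to the same triangle the first start succeeds, and otherwise the chains from \<open>x\<close> and
  \<open>y\<close> end at different vertices and the second one does. Without diamonds, two adjacent triangles
  work unless they form the prism. If every vertex is in a diamond, the graph is a necklace, and the
  bound is sharp since each diamond contains two middle vertices with the same closed neighborhood.
\<close>


text \<open>Meant for the arcs inside a vertex set, with reversal as the fixed-point-free
  involution.\<close>

lemma even_card_involution:
  assumes "finite A" "\<And>x. x \<in> A \<Longrightarrow> f x \<in> A" "\<And>x. x \<in> A \<Longrightarrow> f (f x) = x"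
    "\<And>x. x \<in> A \<Longrightarrow> f x \<noteq> x"
  shows "even (card A)"
  using assms
proof (induction "card A" arbitrary: A rule: less_induct)
  case less
  show ?case
  proof (cases "A = {}")
    case False
    then obtain x where x: "x \<in> A" by blast
    let ?B = "A - {x, f x}"
    have fx: "f x \<in> A" "f x \<noteq> x" "f (f x) = x" using less.prems x by blast+
    have "card A = card ?B + 2"
      using card_Diff_subset[of "{x, f x}" A] card_mono[of A "{x, f x}"] x fx less.prems(1) by auto
    moreover have "even (card ?B)"
    proof (rule less.hyps)
      show "card ?B < card A" using calculation by simp
      show "f y \<in> ?B" if "y \<in> ?B" for y
        using that less.prems(2,3)[of y] fx by auto
    qed (use less.prems in auto)
    ultimately show ?thesis by simp
  qed simp
qed

section \<open>The setting as an adjacency relation\<close>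

text \<open>Connectedness takes the form in which it is applied: no nonempty proper subset is closed
  under adjacency. \<open>no_K4\<close> forbids K4 as a subgraph, which for a connected cubic graph
  amounts to not being K4.\<close>

locale cubic_claw_free =
  fixes V :: "'a set" and adj :: "'a \<Rightarrow> 'a \<Rightarrow> bool"
  assumes finite_V: "finite V"
    and adj_V: "adj u v \<Longrightarrow> u \<in> V"
    and adj_sym: "adj u v \<Longrightarrow> adj v u"
    and adj_irrefl: "\<not> adj v v"
    and degree: "v \<in> V \<Longrightarrow> card {w. adj v w} = 3"
    and no_claw: "\<lbrakk>adj v x; adj v y; adj v z; x \<noteq> y; y \<noteq> z; x \<noteq> z\<rbrakk> \<Longrightarrow> adj x y \<or> adj y z \<or> adj x z"
    and no_K4: "\<lbrakk>adj a b; adj a c; adj a d; adj b c; adj b d\<rbrakk> \<Longrightarrow> \<not> adj c d"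
    and connected: "\<lbrakk>U \<subseteq> V; U \<noteq> {}; \<And>u v. u \<in> U \<Longrightarrow> adj u v \<Longrightarrow> v \<in> U\<rbrakk> \<Longrightarrow> U = V"
begin

section \<open>Triangles, diamonds and the external edges between them\<close>

lemma adj_V': "adj u v \<Longrightarrow> v \<in> V"
  using adj_V adj_sym by blast

lemma adj_neq: "adj u v \<Longrightarrow> u \<noteq> v"
  using adj_irrefl by blast

lemma nbrs_eq:
  assumes "adj v x" "adj v y" "adj v z" "x \<noteq> y" "y \<noteq> z" "x \<noteq> z"
  shows "adj v w \<longleftrightarrow> w \<in> {x, y, z}"
proof -
  have "card {w. adj v w} = 3" using degree adj_V assms(1) by blast
  then have "finite {w. adj v w}" using card.infinite by fastforce
  moreover have "{x, y, z} \<subseteq> {w. adj v w}" "card {x, y, z} = 3" using assms by auto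
  ultimately have "{x, y, z} = {w. adj v w}" using \<open>card {w. adj v w} = 3\<close> card_subset_eq by metis
  then show ?thesis by blast
qed

lemma ex_third_nbr:
  assumes "v \<in> V" obtains z where "adj v z" "z \<noteq> x" "z \<noteq> y"
proof -
  have "card {w. adj v w} = 3" using degree assms by blast
  moreover have "card {x, y} \<le> 2" by (simp add: card_insert_if)
  ultimately have "\<not> {w. adj v w} \<subseteq> {x, y}"
    using card_mono[of "{x, y}" "{w. adj v w}"] by auto
  then show ?thesis using that by blast
qed

text \<open>The connected components of the relation \<open>inn\<close> below are the triangles and diamonds that
  partition the graph, and every vertex is incident with at most one \<open>ext\<close> edge.\<close>

definition ext :: "'a \<Rightarrow> 'a \<Rightarrow> bool" where
  "ext u v \<longleftrightarrow> adj u v \<and> (\<forall>w. \<not> (adj u w \<and> adj v w))"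

definition inn :: "'a \<Rightarrow> 'a \<Rightarrow> bool" where
  "inn u v \<longleftrightarrow> adj u v \<and> \<not> ext u v"

text \<open>\<open>a\<close> and \<open>b\<close> are the ends, \<open>c\<close> and
  \<open>d\<close> the middle vertices. That the ends are nonadjacent follows from the absence of
  K4, see \<open>dia_not_adj\<close>.\<close>

definition dia :: "'a \<Rightarrow> 'a \<Rightarrow> 'a \<Rightarrow> 'a \<Rightarrow> bool" where
  "dia a b c d \<longleftrightarrow> a \<noteq> b \<and> adj a c \<and> adj a d \<and> adj b c \<and> adj b d \<and> adj c d"

definition DV :: "'a set" where
  "DV = {v. \<exists>a b c d. dia a b c d \<and> v \<in> {a, b, c, d}}"

lemma ext_sym: "ext u v \<Longrightarrow> ext v u"
  unfolding ext_def using adj_sym by blast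

lemma inn_sym: "inn u v \<Longrightarrow> inn v u"
  unfolding inn_def using adj_sym ext_sym by blast

lemma ext_adj: "ext u v \<Longrightarrow> adj u v" and inn_adj: "inn u v \<Longrightarrow> adj u v"
  by (auto simp: ext_def inn_def)

lemma adj_cases: "adj u v \<Longrightarrow> ext u v \<or> inn u v"
  by (auto simp: inn_def)

lemma inn_not_ext: "inn u v \<Longrightarrow> \<not> ext u v"
  by (auto simp: inn_def)

lemma innI: "\<lbrakk>adj u v; adj u w; adj v w\<rbrakk> \<Longrightarrow> inn u v"
  by (auto simp: inn_def ext_def)

lemma innE: assumes "inn u v" obtains w where "adj u v" "adj u w" "adj v w"
  using assms by (auto simp: inn_def ext_def)

text \<open>Among the three neighbors of \<open>u\<close>, claw-freeness yields an edge, and this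
  edge meets \<open>v\<close> or \<open>w\<close>. It would put one of the two supposed external
  edges in a triangle.\<close>

lemma ext_unique:
  assumes "ext u v" "ext u w" shows "v = w"
proof (rule ccontr)
  assume neq: "v \<noteq> w"
  have uv: "adj u v" "adj u w" using assms ext_adj by auto
  obtain z where z: "adj u z" "z \<noteq> v" "z \<noteq> w" using ex_third_nbr adj_V uv(1) by metis
  have "adj v w \<or> adj w z \<or> adj v z" using no_claw[of u v w z] uv z neq by blast
  then show False using assms uv z adj_sym unfolding ext_def by blast
qed

lemma dia_adj:
  assumes "dia a b c d"
  shows "adj a c" "adj a d" "adj b c" "adj b d" "adj c d"
    "adj c a" "adj d a" "adj c b" "adj d b" "adj d c"
    "a \<noteq> b" "a \<noteq> c" "a \<noteq> d" "b \<noteq> c" "b \<noteq> d" "c \<noteq> d"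
  using assms adj_sym adj_neq unfolding dia_def by blast+

lemma dia_flip: "dia a b c d \<Longrightarrow> dia b a c d"
  and dia_swap: "dia a b c d \<Longrightarrow> dia a b d c"
  unfolding dia_def using adj_sym by blast+

lemma dia_in_V: "dia a b c d \<Longrightarrow> {a, b, c, d} \<subseteq> V"
  using dia_adj(1-8) adj_V by (metis empty_subsetI insert_subset)

lemma dia_in_DV: "dia a b c d \<Longrightarrow> {a, b, c, d} \<subseteq> DV"
  unfolding DV_def by blast

lemma DV_V: "DV \<subseteq> V"
  unfolding DV_def using dia_in_V by blast

lemma dia_not_adj: "dia a b c d \<Longrightarrow> \<not> adj a b"
  using no_K4[of c d a b] dia_adj(5-10) by metis

lemma dia_nbrs_c: assumes "dia a b c d" shows "adj c w \<longleftrightarrow> w \<in> {a, b, d}"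
  using nbrs_eq[of c a b d w] dia_adj[OF assms] by blast

lemma dia_nbrs_d: assumes "dia a b c d" shows "adj d w \<longleftrightarrow> w \<in> {a, b, c}"
  using dia_nbrs_c[OF dia_swap[OF assms]] by blast

lemma dia_inn:
  assumes "dia a b c d"
  shows "inn a c" "inn a d" "inn b c" "inn b d" "inn c d" "inn c a" "inn d a" "inn c b" "inn d b" "inn d c"
  using dia_adj[OF assms] innI by metis+

text \<open>The middle vertices have all three neighbors inside the diamond, so the third neighbor
  of an end is adjacent to neither of them and the edge to it lies in no triangle.\<close>

lemma dia_ext:
  assumes "dia a b c d"
  obtains v where "ext a v" "v \<notin> {a, b, c, d}" "\<And>w. adj a w \<longleftrightarrow> w \<in> {c, d, v}"
proof -
  note D = dia_adj[OF assms]
  obtain v where v: "adj a v" "v \<noteq> c" "v \<noteq> d" using ex_third_nbr adj_V D(1) by metis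
  have out: "v \<notin> {a, b, c, d}" using v dia_not_adj[OF assms] adj_neq by blast
  have nb: "adj a w \<longleftrightarrow> w \<in> {c, d, v}" for w using nbrs_eq[of a c d v w] D v by blast
  have "\<not> adj v c" "\<not> adj v d"
    using out adj_sym[of v] dia_nbrs_c[OF assms, of v] dia_nbrs_d[OF assms, of v] by auto
  then have "ext a v" unfolding ext_def using v(1) nb adj_irrefl[of v] by auto
  then show ?thesis using that out nb by blast
qed

lemma dia_inn_closed_a:
  assumes "dia a b c d" "inn a w" shows "w \<in> {a, b, c, d}"
proof -
  obtain v where v: "ext a v" "\<And>w. adj a w \<longleftrightarrow> w \<in> {c, d, v}" using dia_ext[OF assms(1)] by metis
  have "w \<noteq> v" using v(1) assms(2) inn_not_ext by blast
  then show ?thesis using v(2) inn_adj[OF assms(2)] by blast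
qed

lemma dia_inn_closed:
  assumes "dia a b c d" "u \<in> {a, b, c, d}" "inn u w" shows "w \<in> {a, b, c, d}"
  using assms(2) dia_inn_closed_a[OF assms(1), of w] dia_inn_closed_a[OF dia_flip[OF assms(1)], of w]
    dia_nbrs_c[OF assms(1), of w] dia_nbrs_d[OF assms(1), of w] inn_adj[OF assms(3)] assms(3) by auto

text \<open>Closure is assumed only at vertices of \<open>DV\<close>, which is what
  \<open>unit_ok\<close> supplies. It suffices because \<open>c\<close> is joined by
  \<open>inn\<close> to all other vertices of the diamond.\<close>

lemma inn_closed_dia:
  assumes "dia a b c d" "u \<in> {a, b, c, d}" "u \<in> U"
    and "\<And>u w. u \<in> U \<Longrightarrow> u \<in> DV \<Longrightarrow> inn u w \<Longrightarrow> w \<in> U"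
  shows "{a, b, c, d} \<subseteq> U"
proof -
  have step: "x \<in> U \<Longrightarrow> x \<in> {a, b, c, d} \<Longrightarrow> inn x w \<Longrightarrow> w \<in> U" for x w
    using assms(4) dia_in_DV[OF assms(1)] by blast
  have "c \<in> U \<or> d \<in> U" using assms(2,3) step dia_inn[OF assms(1)] by blast
  then have "c \<in> U" using step dia_inn[OF assms(1)] by blast
  then show ?thesis using step[of c] dia_inn[OF assms(1)] by blast
qed

text \<open>All edges at a middle vertex are \<open>inn\<close>, so an external edge meets a diamond
  at an end, and \<open>dia_flip\<close> makes this end the first argument.\<close>

lemma DV_ext_end:
  assumes "u \<in> DV" "ext v u" obtains b c d where "dia u b c d"
proof -
  obtain a b c d where D: "dia a b c d" "u \<in> {a, b, c, d}" using assms(1) unfolding DV_def by blast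
  have uv: "adj u v" "\<not> inn u v" using assms(2) ext_sym ext_adj inn_not_ext by blast+
  have "u \<noteq> c" using dia_inn[OF D(1)] dia_nbrs_c[OF D(1), of v] uv by auto
  moreover have "u \<noteq> d" using dia_inn[OF D(1)] dia_nbrs_d[OF D(1), of v] uv by auto
  ultimately show ?thesis using D that dia_flip by blast
qed

lemma inn_DV: assumes "inn u v" shows "u \<in> DV \<longleftrightarrow> v \<in> DV"
proof -
  have "u \<in> DV \<Longrightarrow> inn u v \<Longrightarrow> v \<in> DV" for u v
  proof -
    assume "u \<in> DV" "inn u v"
    then obtain a b c d where D: "dia a b c d" "u \<in> {a, b, c, d}" unfolding DV_def by blast
    then show "v \<in> DV" using dia_inn_closed[OF D \<open>inn u v\<close>] dia_in_DV[OF D(1)] by blast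
  qed
  then show ?thesis using assms inn_sym by blast
qed

text \<open>Claw-freeness gives two adjacent neighbors \<open>y\<close>, \<open>z\<close> of
  \<open>x\<close>. If the third neighbor \<open>v\<close> were adjacent to one of them,
  \<open>x\<close> would be a middle vertex of a diamond.\<close>

lemma triangle_cases:
  assumes "x \<in> V" "x \<notin> DV"
  obtains y z v where "inn x y" "inn x z" "inn y z" "ext x v" "y \<notin> DV" "z \<notin> DV"
    "x \<noteq> y" "x \<noteq> z" "y \<noteq> z" "v \<noteq> x" "v \<noteq> y" "v \<noteq> z"
    "\<And>w. adj x w \<longleftrightarrow> w \<in> {y, z, v}" "\<And>w. inn x w \<longleftrightarrow> w \<in> {y, z}"
proof -
  have "\<exists>y z. adj x y \<and> adj x z \<and> adj y z"
  proof -
    obtain p where "adj x p" using ex_third_nbr assms(1) by metis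
    moreover obtain q where "adj x q" "q \<noteq> p" using ex_third_nbr assms(1) by metis
    moreover obtain r where "adj x r" "r \<noteq> p" "r \<noteq> q" using ex_third_nbr assms(1) by metis
    ultimately show ?thesis using no_claw[of x p q r] by blast
  qed
  then obtain y z where yz: "adj x y" "adj x z" "adj y z" by blast
  obtain v where v: "adj x v" "v \<noteq> y" "v \<noteq> z" using ex_third_nbr assms(1) by metis
  have ne: "x \<noteq> y" "x \<noteq> z" "y \<noteq> z" "v \<noteq> x" using yz v adj_neq by blast+
  have nb: "adj x w \<longleftrightarrow> w \<in> {y, z, v}" for w using nbrs_eq[of x y z v w] yz v ne by blast
  have "\<not> adj v y"
  proof
    assume "adj v y"
    then have "dia z v x y" unfolding dia_def using yz v adj_sym by blast
    then show False using dia_in_DV assms(2) by blast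
  qed
  moreover have "\<not> adj v z"
  proof
    assume "adj v z"
    then have "dia y v x z" unfolding dia_def using yz v adj_sym by blast
    then show False using dia_in_DV assms(2) by blast
  qed
  ultimately have e: "ext x v" unfolding ext_def using v(1) nb adj_irrefl[of v] by auto
  have i: "inn x y" "inn x z" "inn y z" using yz innI adj_sym by metis+
  have "inn x w \<longleftrightarrow> w \<in> {y, z}" for w
    using i(1,2) e nb[of w] inn_adj[of x w] inn_not_ext[of x w] by auto
  then show ?thesis using that[of y z v] i e assms(2) inn_DV[of x y] inn_DV[of x z] ne v nb by simp
qed

lemma inn_trans_triangle:
  assumes "x \<notin> DV" "inn x y" "inn x z" "y \<noteq> z" shows "inn y z"
proof -
  have "x \<in> V" using assms inn_adj adj_V by blast
  then obtain y' z' where "inn y' z'" "\<And>w. inn x w \<longleftrightarrow> w \<in> {y', z'}"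
    using triangle_cases[OF _ assms(1)] by metis
  then show ?thesis using assms inn_sym by auto
qed

text \<open>Moves \<open>triangle_cases\<close> from \<open>x\<close> to another corner
  \<open>y\<close> while keeping the names of the corners.\<close>

lemma triangle_nbrs:
  assumes "x \<notin> DV" "inn x y" "inn x z" "y \<noteq> z"
  obtains v where "ext y v" "v \<notin> {x, y, z}"
    "\<And>w. adj y w \<longleftrightarrow> w \<in> {x, z, v}" "\<And>w. inn y w \<longleftrightarrow> w \<in> {x, z}"
proof -
  have i: "inn y z" "inn y x" "z \<noteq> x"
    using inn_trans_triangle[OF assms] assms(2,3) inn_sym inn_adj adj_neq by metis+
  have y: "y \<in> V" "y \<notin> DV" using assms inn_DV inn_adj adj_V' by blast+
  obtain p q v where *: "ext y v" "v \<noteq> y" "v \<noteq> p" "v \<noteq> q" "p \<noteq> q"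
    "\<And>w. adj y w \<longleftrightarrow> w \<in> {p, q, v}" "\<And>w. inn y w \<longleftrightarrow> w \<in> {p, q}"
    using triangle_cases[OF y] by metis
  have "{p, q} = {x, z}" using *(7)[of x] *(7)[of z] *(5) i by auto
  then have "x \<in> {p, q}" "z \<in> {p, q}" "\<And>w. w \<in> {p, q} \<longleftrightarrow> w \<in> {x, z}" by auto
  then show ?thesis using that[of v] *(1-4,6,7) by auto
qed


section \<open>Parity of unions of diamonds\<close>

text \<open>Such an \<open>R\<close> is a disjoint union of diamonds, which are removed one by one,
  four vertices at a time.\<close>

lemma even_card_diamonds:
  assumes "R \<subseteq> DV" "\<And>u w. u \<in> R \<Longrightarrow> inn u w \<Longrightarrow> w \<in> R"
  shows "even (card R)"
proof -
  have "finite R" using assms(1) DV_V finite_V finite_subset by metis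
  then show ?thesis using assms
  proof (induction "card R" arbitrary: R rule: less_induct)
    case less
    show ?case
    proof (cases "R = {}")
      case False
      then obtain a b c d v where D: "dia a b c d" "v \<in> {a, b, c, d}" "v \<in> R"
        using less.prems(2) unfolding DV_def by blast
      have sub: "{a, b, c, d} \<subseteq> R" using inn_closed_dia[OF D] less.prems(3) by blast
      have "card {a, b, c, d} = 4" using dia_adj[OF D(1)] by auto
      then have c: "card R = card (R - {a, b, c, d}) + 4"
        using card_Diff_subset[OF _ sub] card_mono[OF less.prems(1) sub] by auto
      have "even (card (R - {a, b, c, d}))"
      proof (rule less.hyps)
        fix u w assume u: "u \<in> R - {a, b, c, d}" "inn u w"
        then have "w \<notin> {a, b, c, d}" using dia_inn_closed[OF D(1) _ inn_sym] by blast
        then show "w \<in> R - {a, b, c, d}" using u less.prems(3) by blast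
      qed (use c less.prems in auto)
      then show ?thesis using c by simp
    qed simp
  qed
qed

text \<open>Parity: a union of diamonds has an even number of vertices, so an even number of its arcs leave it.\<close>

lemma diamonds_no_single_exit:
  assumes R: "R \<subseteq> DV" "\<And>u w. u \<in> R \<Longrightarrow> inn u w \<Longrightarrow> w \<in> R"
    and exit: "\<And>u w. u \<in> R \<Longrightarrow> adj u w \<Longrightarrow> w \<in> R \<or> w = z"
    and z: "z \<notin> DV" "r \<in> R" "adj z r"
  shows False
proof -
  have finR: "finite R" using R(1) DV_V finite_V finite_subset by metis
  let ?A = "SIGMA u:R. {w. adj u w}"
  let ?I = "{(u, w). u \<in> R \<and> w \<in> R \<and> adj u w}"
  have fin_nbrs: "finite {w. adj u w}" for u
    by (rule finite_subset[OF _ finite_V]) (auto dest: adj_V')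
  have "card ?A = (\<Sum>u\<in>R. card {w. adj u w})" using finR fin_nbrs by (simp add: card_SigmaI)
  also have "\<dots> = (\<Sum>u\<in>R. 3)" using degree R(1) DV_V by (intro sum.cong) auto
  finally have "card ?A = 3 * card R" by simp
  then have evA: "even (card ?A)" using even_card_diamonds[OF R] by simp
  have "finite ?A" using finR fin_nbrs by blast
  then have finI: "finite ?I" by (rule rev_finite_subset) auto
  have "even (card ?I)"
    by (rule even_card_involution[OF finI, of prod.swap]) (use adj_sym adj_neq in auto)
  \<comment> \<open>An edge from \<open>R\<close> to \<open>z\<close> is external because
    \<open>z\<close> is outside \<open>DV\<close>, and \<open>z\<close> has only one external edge.
    So exactly one arc leaves \<open>R\<close>, while the arcs in \<open>?I\<close> pair up under
    reversal.\<close>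
  moreover have "?A = insert (r, z) ?I"
  proof -
    have "u = r" if "u \<in> R" "adj u z" for u
    proof -
      have e: "ext z w" if "w \<in> R" "adj z w" for w
        using adj_cases[OF that(2)] inn_DV[of z w] z(1) R(1) that(1) by blast
      then show ?thesis using ext_unique that z(2,3) adj_sym by blast
    qed
    then show ?thesis using exit z adj_sym by blast
  qed
  moreover have "(r, z) \<notin> ?I" using z R(1) by blast
  ultimately have "odd (card ?A)" using finI by simp
  then show False using evA by blast
qed

section \<open>The forcing process and partial colorings\<close>

definition fstep :: "'a set \<Rightarrow> 'a set \<Rightarrow> bool" where
  "fstep C C' \<longleftrightarrow> (\<exists>u \<in> C. \<exists>v. {w. adj u w \<and> w \<notin> C} = {v} \<and> C' = insert v C)"

abbreviation reach :: "'a set \<Rightarrow> 'a set \<Rightarrow> bool" where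
  "reach \<equiv> fstep\<^sup>*\<^sup>*"

text \<open>Admitting a target that is already colored spares a case distinction at every later
  force.\<close>

lemma reach_force:
  assumes "reach A B" "u \<in> B" "adj u v" "\<And>w. adj u w \<Longrightarrow> w \<in> B \<or> w = v"
  shows "reach A (insert v B)"
proof (cases "v \<in> B")
  case True
  then show ?thesis using assms(1) by (simp add: insert_absorb)
next
  case False
  then have "{w. adj u w \<and> w \<notin> B} = {v}" using assms by blast
  then have "fstep B (insert v B)" unfolding fstep_def using assms(2) by blast
  then show ?thesis using assms(1) by (meson rtranclp.rtrancl_into_rtrancl)
qed

text \<open>Additional colors never block a force: it stays available or its target is already
  colored.\<close>

lemma reach_mono: "reach A B \<Longrightarrow> reach (A \<union> X) (B \<union> X)"
proof (induction rule: rtranclp_induct)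
  case (step B C)
  then obtain u v where u: "u \<in> B" "{w. adj u w \<and> w \<notin> B} = {v}" "C = insert v B"
    unfolding fstep_def by blast
  then have "reach (A \<union> X) (insert v (B \<union> X))"
    using reach_force[OF step.IH, of u v] by blast
  then show ?case using u(3) by simp
qed simp

definition total :: "'a set \<Rightarrow> bool" where
  "total S \<longleftrightarrow> (\<forall>v\<in>S. \<exists>w\<in>S. adj v w)"

text \<open>Colored sets in the construction contain each diamond completely or not at all, and a
  triangle is either completely colored or entered only from outside.\<close>

definition unit_ok :: "'a set \<Rightarrow> bool" where
  "unit_ok U \<longleftrightarrow> (\<forall>u\<in>U. (\<forall>w. inn u w \<longrightarrow> w \<in> U) \<or> (u \<notin> DV \<and> (\<exists>v\<in>U. ext u v)))"

text \<open>\<open>S\<close> is the part of the total forcing set chosen so far; \<open>U\<close> is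
  colored from \<open>S\<close> but may still allow further forces.\<close>

definition good :: "'a set \<Rightarrow> 'a set \<Rightarrow> bool" where
  "good S U \<longleftrightarrow> S \<subseteq> U \<and> U \<subseteq> V \<and> total S \<and> reach S U \<and> unit_ok U"

definition stuck :: "'a set \<Rightarrow> bool" where
  "stuck U \<longleftrightarrow> (\<forall>u\<in>U. \<forall>v. adj u v \<longrightarrow> v \<notin> U \<longrightarrow> (\<exists>w. adj u w \<and> w \<notin> U \<and> w \<noteq> v))"

lemma total_Un: "total S \<Longrightarrow> total T \<Longrightarrow> total (S \<union> T)"
  unfolding total_def by blast

lemma unit_ok_Un: "unit_ok U \<Longrightarrow> unit_ok W \<Longrightarrow> unit_ok (U \<union> W)"
  unfolding unit_ok_def by blast

lemma unit_ok_insert: "\<lbrakk>unit_ok U; u \<in> U; ext u v; v \<notin> DV\<rbrakk> \<Longrightarrow> unit_ok (insert v U)"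
  unfolding unit_ok_def using ext_sym by blast

lemma unit_ok_inn_closed: "(\<And>u w. u \<in> U \<Longrightarrow> inn u w \<Longrightarrow> w \<in> U) \<Longrightarrow> unit_ok U"
  unfolding unit_ok_def by blast

lemma unit_ok_dia: "dia a b c d \<Longrightarrow> unit_ok {a, b, c, d}"
  by (rule unit_ok_inn_closed) (rule dia_inn_closed)

lemma triangle_inn:
  assumes "x \<notin> DV" "inn x y" "inn x z" "y \<noteq> z" "u \<in> {x, y, z}" "inn u w"
  shows "w \<in> {x, y, z}"
proof -
  have "\<And>w. inn y w \<longleftrightarrow> w \<in> {x, z}" using triangle_nbrs[OF assms(1-4)] by metis
  moreover have "\<And>w. inn z w \<longleftrightarrow> w \<in> {x, y}"
    using triangle_nbrs[OF assms(1,3,2)] assms(4) by metis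
  moreover have "inn x w \<Longrightarrow> w \<in> {y, z}"
  proof -
    assume "inn x w"
    moreover obtain p q where "\<And>w. inn x w \<longleftrightarrow> w \<in> {p, q}"
      using triangle_cases[of x] assms(1,2) inn_adj adj_V by metis
    ultimately show ?thesis using assms(2,3,4) by auto
  qed
  ultimately show ?thesis using assms(5,6) by auto
qed

lemma unit_ok_triangle: "\<lbrakk>x \<notin> DV; inn x y; inn x z; y \<noteq> z\<rbrakk> \<Longrightarrow> unit_ok {x, y, z}"
  by (rule unit_ok_inn_closed) (rule triangle_inn)

lemma unit_ok_dia_sub:
  assumes "unit_ok U" "dia a b c d" "u \<in> {a, b, c, d}" "u \<in> U"
  shows "{a, b, c, d} \<subseteq> U"
  using inn_closed_dia[OF assms(2-4)] assms(1) unfolding unit_ok_def by blast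

text \<open>\<open>unit_ok\<close> colors the whole diamond of \<open>u\<close>, so uncolored
  neighbors of \<open>u\<close> lie across external edges. There is at most one of these, whereas a
  stuck vertex with an uncolored neighbor has two.\<close>

lemma stuck_DV:
  assumes "unit_ok U" "stuck U" "u \<in> U" "u \<in> DV" "adj u w" shows "w \<in> U"
proof (rule ccontr)
  assume w: "w \<notin> U"
  then obtain x where x: "adj u x" "x \<notin> U" "x \<noteq> w" using assms unfolding stuck_def by blast
  have "\<not> inn u y" if "y \<notin> U" for y using that assms unfolding unit_ok_def by blast
  then have "ext u w" "ext u x" using w x assms(5) adj_cases by blast+
  then show False using ext_unique x by blast
qed

lemma stuck_inn_closed:
  assumes "stuck U" "u \<in> U" "\<And>w. inn u w \<Longrightarrow> w \<in> U" "adj u w" shows "w \<in> U"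
proof (rule ccontr)
  assume w: "w \<notin> U"
  then obtain x where x: "adj u x" "x \<notin> U" "x \<noteq> w" using assms unfolding stuck_def by blast
  have "\<not> inn u y" if "y \<notin> U" for y using that assms(3) by blast
  then have "ext u w" "ext u x" using w x assms(4) adj_cases by blast+
  then show False using ext_unique x by blast
qed

lemma good_finite: "good S U \<Longrightarrow> finite S" "good S U \<Longrightarrow> finite U"
  unfolding good_def using finite_V finite_subset by metis+

lemma good_step:
  assumes "good S U" "T \<subseteq> W" "W \<subseteq> V" "total T" "unit_ok (U \<union> W)" "reach (S \<union> T) (U \<union> W)"
  shows "good (S \<union> T) (U \<union> W)"
  using assms total_Un unfolding good_def by blast

section \<open>Extending a partial coloring at no loss of balance\<close>

text \<open>The balance \<open>2 * card S - card (U \<inter> DV)\<close> is preserved exactly: a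
  vertex outside \<open>DV\<close> is colored for free, and a diamond entered at \<open>v\<close>
  costs its two middle vertices and adds four.\<close>

lemma macro_force:
  assumes g: "good S U" and u: "u \<in> U" "adj u v" "v \<notin> U" "\<And>w. adj u w \<Longrightarrow> w \<notin> U \<Longrightarrow> w = v"
  obtains S' U' where "good S' U'" "U \<subset> U'" "2 * card S' + card (U \<inter> DV) = 2 * card S + card (U' \<inter> DV)"
proof (cases "v \<in> DV")
  case False
  have "unit_ok (insert v U)"
  proof (cases "ext u v")
    case True
    then show ?thesis using unit_ok_insert g u False unfolding good_def by blast
  next
    \<comment> \<open>The force runs inside a triangle. Its third vertex \<open>z\<close> must be
      colored already, so \<open>v\<close> completes the triangle.\<close>
    case n: False
    then have i: "inn u v" using u adj_cases by blast
    then have "u \<in> V" "u \<notin> DV" using False inn_DV u adj_V by blast+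
    then obtain p q where pq: "inn u p" "inn u q" "p \<noteq> q" using triangle_cases by metis
    then obtain z where z: "inn u z" "z \<noteq> v" by metis
    then have zU: "z \<in> U" using u inn_adj by blast
    have "w \<in> insert v U" if "inn v w" for w
      using triangle_inn[OF \<open>u \<notin> DV\<close> i z(1), of v w] that z zU u(1) by blast
    moreover have "unit_ok U" using g unfolding good_def by blast
    ultimately show ?thesis unfolding unit_ok_def by blast
  qed
  moreover have "reach S (insert v U)" using reach_force[of S U u v] g u unfolding good_def by blast
  ultimately have "good S (insert v U)" using g u adj_V' unfolding good_def by blast
  moreover have "insert v U \<inter> DV = U \<inter> DV" using False by blast
  ultimately show ?thesis using that[of S "insert v U"] u(3) by auto
next
  case True
  have ok: "unit_ok U" using g unfolding good_def by blast
  \<comment> \<open>A colored vertex of \<open>DV\<close> has its whole diamond colored. Hence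
    \<open>v\<close> is reached across an external edge and is an end of a diamond with no colored
    vertex.\<close>
  have "\<not> inn u v" using ok True u(1,3) inn_DV[of u v] unfolding unit_ok_def by blast
  then have e: "ext u v" using u adj_cases by blast
  obtain b c d where D: "dia v b c d" using DV_ext_end[OF True e] by blast
  have disj: "{v, b, c, d} \<inter> U = {}" using unit_ok_dia_sub[OF ok D] u(3) by blast
  have ne: "c \<noteq> d" "v \<noteq> b" "v \<noteq> c" "v \<noteq> d" "b \<noteq> c" "b \<noteq> d" using dia_adj[OF D] by auto
  let ?S = "S \<union> {c, d}" and ?U = "U \<union> {v, b, c, d}"
  have "reach ?S (U \<union> {c, d})" using reach_mono g unfolding good_def by blast
  then have "reach ?S (insert v (U \<union> {c, d}))"
    by (rule reach_force[of _ _ u]) (use u in blast)+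
  then have "reach ?S (insert b (insert v (U \<union> {c, d})))"
    by (rule reach_force[of _ _ c]) (use dia_nbrs_c[OF D] in auto)
  moreover have "insert b (insert v (U \<union> {c, d})) = ?U" by blast
  moreover have "total {c, d}" unfolding total_def using dia_adj[OF D] by blast
  ultimately have "good ?S ?U"
    using good_step[OF g, of "{c, d}" "{v, b, c, d}"] dia_in_V[OF D] unit_ok_Un[OF ok unit_ok_dia[OF D]]
    by auto
  moreover have "U \<subset> ?U" using u(3) by blast
  moreover have "card ?S = card S + 2"
  proof -
    have "S \<inter> {c, d} = {}" using disj g unfolding good_def by blast
    then show ?thesis using card_Un_disjoint[of S "{c, d}"] good_finite[OF g] ne by auto
  qed
  moreover have "card (?U \<inter> DV) = card (U \<inter> DV) + 4"
  proof -
    have "?U \<inter> DV = (U \<inter> DV) \<union> {v, b, c, d}" using dia_in_DV[OF D] by blast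
    moreover have "card {v, b, c, d} = 4" using ne by auto
    ultimately show ?thesis
      using card_Un_disjoint[of "U \<inter> DV" "{v, b, c, d}"] good_finite[OF g] disj by auto
  qed
  ultimately show ?thesis using that[of ?S ?U] by linarith
qed

text \<open>The balance over \<open>DV\<close> is recorded as an equality, so that all vertices of
  \<open>Q\<close> outside \<open>DV\<close> can later be counted as profit.\<close>

lemma closure_exists:
  assumes "good S U"
  obtains S' Q where "good S' Q" "U \<subseteq> Q" "stuck Q"
    "2 * card S' + card (U \<inter> DV) = 2 * card S + card (Q \<inter> DV)"
proof -
  have "\<exists>S' Q. good S' Q \<and> U \<subseteq> Q \<and> stuck Q \<and>
      2 * card S' + card (U \<inter> DV) = 2 * card S + card (Q \<inter> DV)"
    using assms
  proof (induction "card (V - U)" arbitrary: S U rule: less_induct)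
    case less
    show ?case
    proof (cases "stuck U")
      case False
      then obtain u v where "u \<in> U" "adj u v" "v \<notin> U" "\<And>w. adj u w \<Longrightarrow> w \<notin> U \<Longrightarrow> w = v"
        unfolding stuck_def by blast
      then obtain S' U' where S': "good S' U'" "U \<subset> U'"
        "2 * card S' + card (U \<inter> DV) = 2 * card S + card (U' \<inter> DV)"
        using macro_force[OF less.prems] by metis
      have "V - U' \<subset> V - U" using S' unfolding good_def by blast
      then have "card (V - U') < card (V - U)" using finite_V psubset_card_mono by (metis finite_Diff)
      then obtain S'' Q where "good S'' Q" "U' \<subseteq> Q" "stuck Q"
        "2 * card S'' + card (U' \<inter> DV) = 2 * card S' + card (Q \<inter> DV)"
        using less.hyps S'(1) by metis
      then show ?thesis using S'(2,3) by (intro exI[of _ S''] exI[of _ Q]) auto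
    qed (use less.prems in blast)
  qed
  then show ?thesis using that by blast
qed


text \<open>Once \<open>z\<close>, \<open>a\<close> and \<open>c\<close> are chosen,
  \<open>x\<close> forces \<open>y\<close>, then \<open>a\<close> forces \<open>d\<close>, then
  \<open>c\<close> forces \<open>b\<close>: three chosen vertices for six new ones.\<close>

lemma triangle_step_diamond:
  assumes g: "good S U" and x: "x \<in> U" "x \<notin> DV" "ext x v" "v \<in> U"
    and yz: "inn x y" "inn x z" "y \<noteq> z" "y \<notin> U" "z \<notin> U"
    and a: "ext z a" "a \<in> DV" "a \<notin> U"
  obtains S' U' where "good S' U'" "U \<subset> U'" "2 * card S' + card U \<le> 2 * card S + card U'"
proof -
  obtain b c d where D: "dia a b c d" using DV_ext_end[OF a(2,1)] by blast
  have ok: "unit_ok U" using g unfolding good_def by blast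
  have disj: "{a, b, c, d} \<inter> U = {}" using unit_ok_dia_sub[OF ok D] a(3) by blast
  have ne: "a \<noteq> b" "a \<noteq> c" "a \<noteq> d" "b \<noteq> c" "b \<noteq> d" "c \<noteq> d" using dia_adj[OF D] by auto
  have yzDV: "y \<notin> DV" "z \<notin> DV" using x(2) yz inn_DV by blast+
  have yzD: "y \<notin> {a, b, c, d}" "z \<notin> {a, b, c, d}" using yzDV dia_in_DV[OF D] by blast+
  have yzx: "inn y z" using inn_trans_triangle[OF x(2) yz(1-3)] .
  let ?S = "S \<union> {z, a, c}" and ?W = "{x, y, z} \<union> {a, b, c, d}"
  let ?U = "U \<union> ?W"
  have nx: "adj x w \<longleftrightarrow> w \<in> {y, z, v}" for w
    using nbrs_eq[of x y z v] x(3,4) yz inn_adj ext_adj by metis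
  have na: "adj a w \<longleftrightarrow> w \<in> {c, d, z}" for w
    using nbrs_eq[of a c d z] dia_adj[OF D] ext_adj[OF ext_sym[OF a(1)]] ne yzD by auto
  have "reach ?S (U \<union> {z, a, c})" using reach_mono g unfolding good_def by blast
  then have "reach ?S (insert y (U \<union> {z, a, c}))"
    by (rule reach_force[of _ _ x]) (use x nx in auto)
  then have "reach ?S (insert d (insert y (U \<union> {z, a, c})))"
    by (rule reach_force[of _ _ a]) (use na in auto)
  then have "reach ?S (insert b (insert d (insert y (U \<union> {z, a, c}))))"
    by (rule reach_force[of _ _ c]) (use dia_nbrs_c[OF D] in auto)
  moreover have "insert b (insert d (insert y (U \<union> {z, a, c}))) = ?U" using x(1) by blast
  moreover have "total {z, a, c}" unfolding total_def using dia_adj[OF D] ext_adj[OF a(1)] by blast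
  moreover have "unit_ok ?U"
    using unit_ok_Un[OF ok unit_ok_Un[OF unit_ok_triangle[OF x(2) yz(1-3)] unit_ok_dia[OF D]]] .
  moreover have "?W \<subseteq> V" using dia_in_V[OF D] adj_V[OF inn_adj[OF yz(1)]]
    adj_V'[OF inn_adj[OF yz(1)]] adj_V'[OF inn_adj[OF yz(2)]] by blast
  ultimately have gd: "good ?S ?U" using good_step[OF g, of "{z, a, c}" ?W] by auto
  have "card ?S = card S + 3"
  proof -
    have "S \<inter> {z, a, c} = {}" using disj yz g unfolding good_def by blast
    moreover have "card {z, a, c} = 3" using ne yzD by auto
    ultimately show ?thesis using card_Un_disjoint[of S "{z, a, c}"] good_finite[OF g] by auto
  qed
  moreover have "card ?U = card U + 6"
  proof -
    have "?U = U \<union> {y, z, a, b, c, d}" using x(1) by blast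
    moreover have "card {y, z, a, b, c, d} = 6" using ne yzD yz by auto
    moreover have "U \<inter> {y, z, a, b, c, d} = {}" using yz disj by blast
    ultimately show ?thesis using card_Un_disjoint[of U "{y, z, a, b, c, d}"] good_finite[OF g] by auto
  qed
  moreover have "U \<subset> ?U" using yz by blast
  ultimately show ?thesis using that[OF gd] by linarith
qed

lemma triangle_step:
  assumes g: "good S U" and st: "stuck U" and U: "U \<noteq> {}" "U \<noteq> V"
  obtains S' U' where "good S' U'" "U \<subset> U'" "2 * card S' + card U \<le> 2 * card S + card U'"
proof -
  have ok: "unit_ok U" and UV: "U \<subseteq> V" using g unfolding good_def by blast+
  \<comment> \<open>Connectedness gives a colored vertex with an uncolored neighbor. Being stuck
    rules out that it lies in a diamond or in a fully colored triangle, so by \<open>unit_ok\<close>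
    it is a triangle vertex entered across its external edge.\<close>
  obtain x u where x: "x \<in> U" "adj x u" "u \<notin> U" using connected[OF UV U(1)] U(2) by blast
  have xDV: "x \<notin> DV" using stuck_DV[OF ok st] x by blast
  have "\<not> (\<forall>w. inn x w \<longrightarrow> w \<in> U)" using stuck_inn_closed[OF st] x by blast
  then obtain v where v: "ext x v" "v \<in> U" using ok x unfolding unit_ok_def by blast
  obtain y z v' where T: "inn x y" "inn x z" "inn y z" "ext x v'" "y \<notin> DV" "z \<notin> DV"
    "x \<noteq> y" "x \<noteq> z" "y \<noteq> z" "\<And>w. adj x w \<longleftrightarrow> w \<in> {y, z, v'}"
    using triangle_cases[of x] xDV adj_V[OF x(2)] by metis
  have v': "v' = v" using ext_unique T v by blast
  obtain u' where u': "adj x u'" "u' \<notin> U" "u' \<noteq> u" using st x unfolding stuck_def by blast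
  have yzU: "y \<notin> U" "z \<notin> U" using x u' v(2) v' T(10)[of u] T(10)[of u'] by auto
  \<comment> \<open>Such a \<open>p\<close> would not be \<open>inn\<close>-closed either, as
    \<open>U\<close> is stuck. Then \<open>unit_ok\<close> requires a colored external neighbor, but
    its only external neighbor is the uncolored \<open>q\<close>.\<close>
  have out: "p \<notin> U" if "ext q p" "q \<notin> U" for p q
  proof
    assume p: "p \<in> U"
    have a: "adj p q" using ext_adj[OF ext_sym[OF that(1)]] .
    have "p \<notin> DV" using stuck_DV[OF ok st p _ a] that(2) by blast
    moreover have "\<not> (\<forall>w. inn p w \<longrightarrow> w \<in> U)" using stuck_inn_closed[OF st p _ a] that(2) by blast
    ultimately obtain r where "r \<in> U" "ext p r" using ok p unfolding unit_ok_def by blast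
    then show False using ext_unique[OF _ ext_sym[OF that(1)]] that(2) by blast
  qed
  obtain vy where vy: "ext y vy" "vy \<notin> {x, y, z}" "\<And>w. adj y w \<longleftrightarrow> w \<in> {x, z, vy}"
    using triangle_nbrs[OF xDV T(1,2,9)] by metis
  obtain vz where vz: "ext z vz" "vz \<notin> {x, z, y}" "\<And>w. adj z w \<longleftrightarrow> w \<in> {x, y, vz}"
    using triangle_nbrs[OF xDV T(2,1) T(9)[symmetric]] by metis
  have vU: "vy \<notin> U" "vz \<notin> U" using out vy(1) vz(1) yzU by blast+
  have vne: "vy \<noteq> vz" using vz(1) T(9) ext_unique[OF ext_sym[OF vy(1)]] ext_sym by blast
  \<comment> \<open>Coloring just one end of a diamond would violate \<open>unit_ok\<close>, so an
    external neighbor in \<open>DV\<close> calls for the step that takes in the whole diamond.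
    Otherwise \<open>y\<close> and \<open>z\<close> force \<open>vy\<close> and \<open>vz\<close>,
    four vertices for two.\<close>
  consider "vz \<in> DV" | "vy \<in> DV" | "vy \<notin> DV" "vz \<notin> DV" by blast
  then show ?thesis
  proof cases
    case 1
    show ?thesis
      by (rule triangle_step_diamond[OF g x(1) xDV v T(1,2,9) yzU vz(1) 1 vU(2)]) (rule that)
  next
    case 2
    show ?thesis
      by (rule triangle_step_diamond[OF g x(1) xDV v T(2,1) T(9)[symmetric] yzU(2,1) vy(1) 2 vU(1)])
        (rule that)
  next
    case 3
    let ?S = "S \<union> {y, z}" and ?W = "{x, y, z, vy, vz}"
    let ?U = "U \<union> ?W"
    have "reach ?S (U \<union> {y, z})" using reach_mono g unfolding good_def by blast
    then have "reach ?S (insert vy (U \<union> {y, z}))"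
      by (rule reach_force[of _ _ y]) (use x(1) vy in auto)
    then have "reach ?S (insert vz (insert vy (U \<union> {y, z})))"
      by (rule reach_force[of _ _ z]) (use x(1) vz in auto)
    moreover have "insert vz (insert vy (U \<union> {y, z})) = ?U" using x(1) by blast
    moreover have "total {y, z}" unfolding total_def using T(3) inn_adj inn_sym by blast
    moreover have "unit_ok ?U"
    proof -
      have "unit_ok (U \<union> {x, y, z})" using unit_ok_Un[OF ok unit_ok_triangle[OF xDV T(1,2,9)]] .
      then have "unit_ok (insert vz (insert vy (U \<union> {x, y, z})))"
        using unit_ok_insert[OF unit_ok_insert[OF _ _ vy(1) 3(1)] _ vz(1) 3(2)] by blast
      moreover have "insert vz (insert vy (U \<union> {x, y, z})) = ?U" by blast
      ultimately show ?thesis by simp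
    qed
    moreover have "?W \<subseteq> V"
      using x(1) UV adj_V'[OF inn_adj[OF T(1)]] adj_V'[OF inn_adj[OF T(2)]]
        adj_V'[OF ext_adj[OF vy(1)]] adj_V'[OF ext_adj[OF vz(1)]] by blast
    ultimately have gd: "good ?S ?U" using good_step[OF g, of "{y, z}" ?W] by auto
    have "card ?S = card S + 2"
    proof -
      have "S \<inter> {y, z} = {}" using yzU g unfolding good_def by blast
      then show ?thesis using card_Un_disjoint[of S "{y, z}"] good_finite[OF g] T(9) by auto
    qed
    moreover have "card ?U = card U + 4"
    proof -
      have "?U = U \<union> {y, z, vy, vz}" using x(1) by blast
      moreover have "card {y, z, vy, vz} = 4" using vy(2) vz(2) vne T(9) by auto
      moreover have "U \<inter> {y, z, vy, vz} = {}" using yzU vU by blast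
      ultimately show ?thesis using card_Un_disjoint[of U "{y, z, vy, vz}"] good_finite[OF g] by auto
    qed
    moreover have "U \<subset> ?U" using yzU by blast
    ultimately show ?thesis using that[OF gd] by linarith
  qed
qed

text \<open>No step increases \<open>2 * card S - card U\<close>. For triangle steps this is their
  estimate; for forces the balance over \<open>DV\<close> is exact and \<open>U\<close> can only
  gain vertices outside \<open>DV\<close>.\<close>

lemma good_extends:
  assumes "good S U" "U \<noteq> {}"
  obtains S' where "good S' V" "2 * card S' + card U \<le> 2 * card S + card V"
proof -
  have "\<exists>S'. good S' V \<and> 2 * card S' + card U \<le> 2 * card S + card V"
    using assms
  proof (induction "card (V - U)" arbitrary: S U rule: less_induct)
    case less
    have step: ?case if S': "good S' U'" "U \<subset> U'" "2 * card S' + card U \<le> 2 * card S + card U'"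
      for S' U'
    proof -
      have "V - U' \<subset> V - U" using S' unfolding good_def by blast
      then have "card (V - U') < card (V - U)" using finite_V psubset_card_mono by (metis finite_Diff)
      then obtain S'' where "good S'' V" "2 * card S'' + card U' \<le> 2 * card S' + card V"
        using less.hyps S'(1,2) by blast
      then show ?thesis using S'(3) by (intro exI[of _ S'']) auto
    qed
    consider "U = V" | "stuck U" "U \<noteq> V" | "\<not> stuck U" by blast
    then show ?case
    proof cases
      case 1
      then show ?thesis using less.prems by auto
    next
      case 2
      show ?thesis by (rule triangle_step[OF less.prems(1) 2(1) less.prems(2) 2(2)]) (rule step)
    next
      case 3
      then obtain u v where "u \<in> U" "adj u v" "v \<notin> U" "\<And>w. adj u w \<Longrightarrow> w \<notin> U \<Longrightarrow> w = v"
        unfolding stuck_def by blast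
      then obtain S' U' where S': "good S' U'" "U \<subset> U'"
        "2 * card S' + card (U \<inter> DV) = 2 * card S + card (U' \<inter> DV)"
        using macro_force[OF less.prems(1)] by metis
      have fin: "finite U'" using S' good_finite by blast
      then have "finite U" using S'(2) finite_subset by blast
      then have "card U = card (U \<inter> DV) + card (U - DV)" "card U' = card (U' \<inter> DV) + card (U' - DV)"
        using fin card_Int_Diff by blast+
      moreover have "card (U - DV) \<le> card (U' - DV)" using S'(2) fin by (intro card_mono) auto
      ultimately have "2 * card S' + card U \<le> 2 * card S + card U'" using S'(3) by linarith
      then show ?thesis using step[OF S'(1,2)] by blast
    qed
  qed
  then show ?thesis using that by blast
qed

section \<open>Profitable starts where a diamond meets a triangle\<close>

definition total_forcing :: "'a set \<Rightarrow> bool" where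
  "total_forcing S \<longleftrightarrow> S \<subseteq> V \<and> total S \<and> reach S V"

text \<open>Strict inequality in the bound; the extremal graphs are those where this fails.\<close>

definition cheap :: bool where
  "cheap \<longleftrightarrow> (\<exists>S. total_forcing S \<and> 2 * card S < card V)"

lemma good_total_forcing: "good S V \<Longrightarrow> total_forcing S"
  unfolding good_def total_forcing_def by blast

lemma half_if_good:
  assumes "good S U" "U \<noteq> {}" "2 * card S \<le> card U"
  shows "\<exists>S. total_forcing S \<and> 2 * card S \<le> card V"
proof -
  obtain S' where "good S' V" "2 * card S' + card U \<le> 2 * card S + card V"
    using good_extends[OF assms(1,2)] by blast
  then show ?thesis using good_total_forcing assms(3) by (intro exI[of _ S']) auto
qed

text \<open>Entering a diamond costs two vertices and colors four, so it keeps the balance; every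
  other vertex of the closure is gained for free.\<close>

lemma cheap_if_closure:
  assumes g: "good S U" "U \<noteq> {}"
    and Q: "\<And>Q. \<lbrakk>U \<subseteq> Q; Q \<subseteq> V; stuck Q; unit_ok Q\<rbrakk> \<Longrightarrow> 2 * card S < card (Q - DV) + card (U \<inter> DV)"
  shows cheap
proof -
  obtain S' Q where S': "good S' Q" "U \<subseteq> Q" "stuck Q"
    "2 * card S' + card (U \<inter> DV) = 2 * card S + card (Q \<inter> DV)"
    using closure_exists[OF g(1)] by metis
  then have "2 * card S < card (Q - DV) + card (U \<inter> DV)" using Q unfolding good_def by blast
  moreover have "card Q = card (Q \<inter> DV) + card (Q - DV)"
    using card_Int_Diff good_finite(2)[OF S'(1)] by blast
  moreover obtain S'' where "good S'' V" "2 * card S'' + card Q \<le> 2 * card S' + card V"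
    using good_extends[OF S'(1)] S'(2) g(2) by blast
  ultimately show ?thesis unfolding cheap_def using S'(4) good_total_forcing
    by (intro exI[of _ S'']) auto
qed

text \<open>\<open>b\<close> is the end next to \<open>w\<close>; it forces \<open>d\<close>, and
  then \<open>c\<close> forces the far end \<open>a\<close>.\<close>

lemma good_diamond_start:
  assumes D: "dia b a c d" and w: "w \<notin> DV" "ext w b"
  shows "good {w, b, c} (insert w {b, a, c, d})"
proof -
  have nb: "adj b x \<longleftrightarrow> x \<in> {c, d, w}" for x
    using nbrs_eq[of b c d w x] dia_adj[OF D] dia_in_DV[OF D] w(1) ext_adj[OF ext_sym[OF w(2)]] by auto
  have "reach {w, b, c} (insert d {w, b, c})"
    by (rule reach_force[of _ _ b]) (use nb in auto)
  then have "reach {w, b, c} (insert a (insert d {w, b, c}))"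
    by (rule reach_force[of _ _ c]) (use dia_nbrs_c[OF D] in auto)
  moreover have "insert a (insert d {w, b, c}) = insert w {b, a, c, d}" by blast
  moreover have "unit_ok (insert w {b, a, c, d})"
    using unit_ok_insert[OF unit_ok_dia[OF D], of b w] w ext_sym by blast
  moreover have "total {w, b, c}" unfolding total_def using ext_adj[OF w(2)] dia_adj[OF D] by blast
  moreover have "w \<in> V" using w(2) ext_adj adj_V by blast
  ultimately show ?thesis unfolding good_def using dia_in_V[OF D] by auto
qed

text \<open>In use, \<open>R\<close> is the chain of diamonds between \<open>w\<close> and
  \<open>v\<close>. It is recorded only as a union of diamonds with these two possible exits, the
  form that the parity argument takes.\<close>

definition diamond_path :: "'a \<Rightarrow> 'a \<Rightarrow> 'a set \<Rightarrow> bool" where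
  "diamond_path w v R \<longleftrightarrow> R \<subseteq> DV \<and> (\<forall>u\<in>R. \<forall>x. inn u x \<longrightarrow> x \<in> R) \<and>
     (\<forall>u\<in>R. \<forall>x. adj u x \<longrightarrow> x \<in> R \<or> x = w \<or> x = v)"

text \<open>The closure \<open>Q\<close> of the start at the diamond next to \<open>w\<close> has at
  most two vertices outside \<open>DV\<close>, as otherwise the graph is cheap. By parity its
  diamonds have an exit other than \<open>w\<close>; so \<open>Q\<close> is \<open>w\<close>, this
  exit \<open>v\<close> and the diamonds between.\<close>

lemma diamond_path_end:
  assumes nc: "\<not> cheap" and w: "w \<notin> DV" "ext w b" "b \<in> DV"
  obtains R v r where "diamond_path w v R" "b \<in> R" "v \<notin> DV" "v \<noteq> w" "\<not> inn w v" "r \<in> R" "ext v r"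
proof -
  obtain a c d where D: "dia b a c d" using DV_ext_end[OF w(3,2)] by blast
  let ?U = "insert w {b, a, c, d}"
  have "?U \<inter> DV = {b, a, c, d}" using dia_in_DV[OF D] w(1) by blast
  then have cU: "card (?U \<inter> DV) = 4" using dia_adj[OF D] by auto
  have "w \<noteq> b" "w \<noteq> c" using dia_in_DV[OF D] w(1) by blast+
  then have cS: "card {w, b, c} = 3" using dia_adj[OF D] by auto
  \<comment> \<open>Three chosen vertices and four vertices of the first diamond: cheapness fails
    only if \<open>card (Q - DV) + 4 \<le> 6\<close>.\<close>
  obtain Q where Q: "?U \<subseteq> Q" "Q \<subseteq> V" "stuck Q" "unit_ok Q" "card (Q - DV) \<le> 2"
  proof -
    have "\<exists>Q. ?U \<subseteq> Q \<and> Q \<subseteq> V \<and> stuck Q \<and> unit_ok Q \<and>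
        \<not> 2 * card {w, b, c} < card (Q - DV) + card (?U \<inter> DV)"
      using cheap_if_closure[OF good_diamond_start[OF D w(1,2)]] nc by blast
    then obtain Q where "?U \<subseteq> Q" "Q \<subseteq> V" "stuck Q" "unit_ok Q"
      "\<not> 2 * card {w, b, c} < card (Q - DV) + card (?U \<inter> DV)" by blast
    then show ?thesis using that[of Q] unfolding cS cU by simp
  qed
  let ?R = "Q \<inter> DV"
  have finQ: "finite Q" using Q(2) finite_V finite_subset by blast
  have R: "?R \<subseteq> DV" "\<And>u x. u \<in> ?R \<Longrightarrow> inn u x \<Longrightarrow> x \<in> ?R"
    using Q(4) inn_DV unfolding unit_ok_def by blast+
  have RQ: "x \<in> Q" if "u \<in> ?R" "adj u x" for u x using stuck_DV[OF Q(4,3)] that by blast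
  have wQ: "w \<in> Q - DV" using Q(1) w(1) by blast
  have "\<not> (\<forall>u x. u \<in> ?R \<longrightarrow> adj u x \<longrightarrow> x \<in> ?R \<or> x = w)"
    using diamonds_no_single_exit[of ?R w b] R Q(1) w ext_adj[OF w(2)] by blast
  then obtain r v where v: "r \<in> ?R" "adj r v" "v \<notin> ?R" "v \<noteq> w" by blast
  have vQ: "v \<in> Q - DV" using RQ v by blast
  have vr: "ext v r"
    using adj_cases[OF v(2)] R(2)[OF v(1)] v(3) ext_sym by blast
  have "card {w, v} = 2" using v(4) by simp
  then have eq: "Q - DV = {w, v}"
    using card_seteq[of "Q - DV" "{w, v}"] finQ Q(5) wQ vQ by simp
  \<comment> \<open>If the chain returned to the triangle of \<open>w\<close>, then \<open>w\<close>
    would have the colored neighbors \<open>v\<close> and \<open>b\<close>. Its third neighbor would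
    be colored as well, a third vertex of \<open>Q\<close> outside \<open>DV\<close>.\<close>
  have nin: "\<not> inn w v"
  proof
    assume i: "inn w v"
    have wV: "w \<in> V" using wQ Q(2) by blast
    obtain z where z: "adj w z" "z \<noteq> v" "z \<noteq> b" using ex_third_nbr[OF wV] by metis
    have wb: "adj w b" "b \<noteq> v" using ext_adj[OF w(2)] w(3) vQ by auto
    have nw: "adj w x \<longleftrightarrow> x \<in> {v, b, z}" for x
      using nbrs_eq[of w v b z x] inn_adj[OF i] wb z by auto
    have "z \<in> Q"
    proof (rule ccontr)
      assume nz: "z \<notin> Q"
      then obtain x where "adj w x" "x \<notin> Q" "x \<noteq> z" using Q(3) wQ z(1) unfolding stuck_def by blast
      then show False using nw[of x] vQ Q(1) by auto
    qed
    moreover have "inn w z" using adj_cases[OF z(1)] ext_unique[OF w(2)] z(3) by blast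
    then have "z \<notin> DV" "z \<noteq> w" using inn_DV w(1) inn_adj adj_neq by blast+
    ultimately show False using eq z(2) by blast
  qed
  have "x \<in> ?R \<or> x = w \<or> x = v" if "u \<in> ?R" "adj u x" for u x
    using RQ[OF that] eq by blast
  then have "diamond_path w v ?R" unfolding diamond_path_def using R by blast
  then show ?thesis using that[of v ?R r] Q(1) w(3) vQ v vr nin by blast
qed


text \<open>If \<open>v\<close> were uncolored, \<open>R \<inter> Q\<close> would be a union of
  diamonds with \<open>w\<close> as its only exit, against parity.\<close>

lemma path_end_mem:
  assumes Q: "unit_ok Q" "stuck Q" and R: "diamond_path w v R"
    and w: "w \<notin> DV" "ext w b" "b \<in> R" "b \<in> Q"
  shows "v \<in> Q"
proof (rule ccontr)
  assume v: "v \<notin> Q"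
  have RQ: "x \<in> Q" if "u \<in> R \<inter> Q" "adj u x" for u x using stuck_DV[OF Q, of u x] that R unfolding diamond_path_def by blast
  show False
  proof (rule diamonds_no_single_exit[of "R \<inter> Q" w b])
    show "x \<in> R \<inter> Q" if "u \<in> R \<inter> Q" "inn u x" for u x
      using R RQ[OF that(1)] that inn_adj unfolding diamond_path_def by blast
    show "x \<in> R \<inter> Q \<or> x = w" if "u \<in> R \<inter> Q" "adj u x" for u x
      using R RQ[OF that] that v unfolding diamond_path_def by blast
  qed (use R w ext_adj in \<open>auto simp: diamond_path_def\<close>)
qed

text \<open>If the graph is not cheap, the chain leaving \<open>x\<close> ends at some
  \<open>v\<close> outside the triangle of \<open>x\<close>. Starting with the triangle added, the
  closure contains \<open>x\<close>, \<open>y\<close>, \<open>z\<close>, \<open>v\<close> and one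
  more vertex outside \<open>DV\<close>, found across the external edge at \<open>y\<close>.\<close>

lemma cheap_if_diamond_meets_triangle:
  assumes x: "x \<notin> DV" "ext x b" "b \<in> DV"
  shows cheap
proof (rule ccontr)
  assume nc: "\<not> cheap"
  obtain a c d where D: "dia b a c d" using DV_ext_end[OF x(3,2)] by blast
  have bD: "{b, a, c, d} \<subseteq> DV" using dia_in_DV[OF D] .
  have xV: "x \<in> V" using x(2) ext_adj adj_V by blast
  obtain y z b' where T: "inn x y" "inn x z" "y \<notin> DV" "z \<notin> DV" "x \<noteq> y" "x \<noteq> z" "y \<noteq> z" "ext x b'"
    "\<And>w. adj x w \<longleftrightarrow> w \<in> {y, z, b'}"
    using triangle_cases[OF xV x(1)] by metis
  have b': "b' = b" using ext_unique T(8) x(2) by blast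
  obtain q where q: "ext y q" "q \<notin> {x, y, z}" "\<And>w. inn y w \<longleftrightarrow> w \<in> {x, z}"
    using triangle_nbrs[OF x(1) T(1,2,7)] by metis
  obtain R v r where R: "diamond_path x v R" "b \<in> R" "v \<notin> DV" "v \<noteq> x" "\<not> inn x v" "r \<in> R" "ext v r"
    using diamond_path_end[OF nc x] by metis
  have vT: "v \<notin> {x, y, z}" using R(4,5) T(1,2) by blast
  \<comment> \<open>\<open>x\<close> occurs in both parts so that each of them is
    \<open>total\<close>; together they have four vertices.\<close>
  let ?S = "{x, b, c} \<union> {x, y}" and ?U = "insert x {b, a, c, d} \<union> {x, y, z}"
  have g0: "good {x, b, c} (insert x {b, a, c, d})" using good_diamond_start[OF D x(1,2)] .
  have "reach ?S (insert x {b, a, c, d} \<union> {x, y})"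
    by (rule reach_mono) (use g0 in \<open>simp add: good_def\<close>)
  then have "reach ?S (insert z (insert x {b, a, c, d} \<union> {x, y}))"
    by (rule reach_force[of _ _ x]) (use T(9) b' in auto)
  moreover have "insert z (insert x {b, a, c, d} \<union> {x, y}) = ?U" by blast
  moreover have "total {x, y}" unfolding total_def using T(1) inn_adj adj_sym by blast
  moreover have "unit_ok ?U"
    using g0 unit_ok_Un unit_ok_triangle[OF x(1) T(1,2,7)] unfolding good_def by blast
  moreover have "{x, y, z} \<subseteq> V" using xV adj_V'[OF inn_adj[OF T(1)]] adj_V'[OF inn_adj[OF T(2)]] by blast
  ultimately have g: "good ?S ?U" using good_step[OF g0, of "{x, y}" "{x, y, z}"] by auto
  have "?U \<inter> DV = {b, a, c, d}" using bD x(1) T(3,4) by blast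
  then have cU: "card (?U \<inter> DV) = 4" using dia_adj[OF D] by auto
  have cS: "card ?S \<le> 4" by (simp add: card_insert_if)
  have cheap
  proof (rule cheap_if_closure[OF g])
    fix Q assume Q: "?U \<subseteq> Q" "Q \<subseteq> V" "stuck Q" "unit_ok Q"
    have vQ: "v \<in> Q" using path_end_mem[OF Q(4,3) R(1) x(1,2) R(2)] Q(1) by blast
    have qQ: "q \<in> Q" using stuck_inn_closed[OF Q(3), of y q] q Q(1) ext_adj by auto
    \<comment> \<open>Four chosen vertices against four diamond vertices: a profit needs five
      vertices of \<open>Q\<close> outside \<open>DV\<close>. The fifth is \<open>q\<close> itself
      or the end of the diamond chain that starts at \<open>q\<close>.\<close>
    have "\<exists>v'. v' \<in> Q - DV \<and> v' \<notin> {x, y, z, v}"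
    proof (cases "q \<in> DV")
      case False
      have "q \<noteq> v" using ext_unique[OF R(7)] ext_sym[OF q(1)] R(1,6) T(3) unfolding diamond_path_def by blast
      then show ?thesis using False qQ q by blast
    next
      case True
      obtain R' v' r' where R': "diamond_path y v' R'" "q \<in> R'" "v' \<notin> DV" "v' \<noteq> y" "\<not> inn y v'"
        "r' \<in> R'" "ext v' r'"
        using diamond_path_end[OF nc T(3) q(1) True] by metis
      have "v' \<in> Q" using path_end_mem[OF Q(4,3) R'(1) T(3) q(1) R'(2) qQ] .
      moreover have "v' \<noteq> v"
      proof
        assume vv: "v' = v"
        then have rr: "r' = r" using R(7) R'(7) ext_unique by blast
        show False
        proof (rule diamonds_no_single_exit[of "R \<inter> R'" v r])
          show "t \<in> R \<inter> R'" if "u \<in> R \<inter> R'" "inn u t" for u t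
            using R(1) R'(1) that unfolding diamond_path_def by blast
          show "t \<in> R \<inter> R' \<or> t = v" if ut: "u \<in> R \<inter> R'" "adj u t" for u t
          proof -
            have "t \<in> R \<or> t = x \<or> t = v" "t \<in> R' \<or> t = y \<or> t = v"
              using R(1) R'(1) ut vv unfolding diamond_path_def by blast+
            moreover have "x \<notin> R'" "y \<notin> R" using R(1) R'(1) x(1) T(3) unfolding diamond_path_def by blast+
            ultimately show ?thesis using T(5) by blast
          qed
        qed (use R R' rr ext_adj in \<open>auto simp: diamond_path_def\<close>)
      qed
      moreover have "v' \<notin> {x, y, z}" using R'(4,5) q(3) by blast
      ultimately show ?thesis using R'(3) by blast
    qed
    then obtain v' where v': "v' \<in> Q - DV" "v' \<notin> {x, y, z, v}" by blast
    have "{x, y, z, v, v'} \<subseteq> Q - DV" using Q(1) x(1) T(3,4) vQ R(3) v'(1) by blast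
    moreover have "card {x, y, z, v, v'} = 5" using T(5-7) vT v'(2) by auto
    moreover have "finite (Q - DV)" using Q(2) finite_V finite_subset by blast
    ultimately have "5 \<le> card (Q - DV)" using card_mono by metis
    then show "2 * card ?S < card (Q - DV) + card (?U \<inter> DV)" using cU cS by linarith
  qed blast
  then show False using nc by blast
qed

section \<open>Starts in graphs with only diamonds or only triangles\<close>

text \<open>Start with two diamonds joined by an edge from \<open>b\<close> to \<open>a'\<close>.
  Choosing both ends of this edge and one middle vertex in each diamond colors all eight vertices
  with four.\<close>

lemma all_diamonds_half:
  assumes "DV = V" "V \<noteq> {}"
  shows "\<exists>S. total_forcing S \<and> 2 * card S \<le> card V"
proof -
  obtain a b c d where D: "dia b a c d" using assms unfolding DV_def by blast
  obtain a' where a': "ext b a'" "a' \<notin> {b, a, c, d}" "\<And>w. adj b w \<longleftrightarrow> w \<in> {c, d, a'}"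
    using dia_ext[OF D] by metis
  have "a' \<in> DV" using adj_V'[OF ext_adj[OF a'(1)]] assms(1) by simp
  then obtain b' c' d' where D': "dia a' b' c' d'" using DV_ext_end[OF _ a'(1)] by metis
  have na': "adj a' w \<longleftrightarrow> w \<in> {c', d', b}" for w
  proof -
    have "b \<notin> {c', d'}" using dia_inn[OF D'] inn_not_ext ext_sym[OF a'(1)] by blast
    then show ?thesis
      using nbrs_eq[of a' c' d' b w] dia_adj[OF D'] ext_adj[OF ext_sym[OF a'(1)]] by auto
  qed
  \<comment> \<open>Diamonds that share a vertex coincide, but \<open>a'\<close> is outside the
    first one.\<close>
  have disj: "{b, a, c, d} \<inter> {a', b', c', d'} = {}"
  proof (rule ccontr)
    assume "\<not> ?thesis"
    then obtain u where u: "u \<in> {b, a, c, d}" "u \<in> {a', b', c', d'}" by blast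
    have "{a', b', c', d'} \<subseteq> {b, a, c, d}"
      by (rule inn_closed_dia[OF D' u(2,1)]) (rule dia_inn_closed[OF D])
    then show False using a'(2) by blast
  qed
  let ?S = "{b, c, a', c'}" and ?U = "{b, a, c, d} \<union> {a', b', c', d'}"
  have "reach ?S (insert d ?S)"
    by (rule reach_force[of _ _ b]) (use a' in auto)
  then have "reach ?S (insert a (insert d ?S))"
    by (rule reach_force[of _ _ c]) (use dia_nbrs_c[OF D] in auto)
  then have "reach ?S (insert d' (insert a (insert d ?S)))"
    by (rule reach_force[of _ _ a']) (use na' in auto)
  then have "reach ?S (insert b' (insert d' (insert a (insert d ?S))))"
    by (rule reach_force[of _ _ c']) (use dia_nbrs_c[OF D'] in auto)
  moreover have "insert b' (insert d' (insert a (insert d ?S))) = ?U" by blast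
  moreover have "total ?S" unfolding total_def using dia_adj[OF D] dia_adj[OF D'] by blast
  moreover have "unit_ok ?U" using unit_ok_Un[OF unit_ok_dia[OF D] unit_ok_dia[OF D']] .
  ultimately have g: "good ?S ?U" unfolding good_def using dia_in_V[OF D] dia_in_V[OF D'] by auto
  have "card ?U = 8"
  proof -
    have "card {b, a, c, d} = 4" "card {a', b', c', d'} = 4"
      using dia_adj[OF D] dia_adj[OF D'] by auto
    then show ?thesis using card_Un_disjoint[OF _ _ disj] by auto
  qed
  moreover have "card ?S \<le> 4" by (simp add: card_insert_if)
  ultimately show ?thesis using half_if_good[OF g] by auto
qed

lemma unit_ok_two_triangles:
  assumes "x \<notin> DV" "inn x y" "inn x z" "y \<noteq> z" "x' \<notin> DV" "inn x' y'" "inn x' z'" "y' \<noteq> z'"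
  shows "unit_ok ({x, y, z} \<union> {x', y', z'})"
  using unit_ok_Un unit_ok_triangle assms by blast

lemma triangles_disjoint:
  assumes "x \<notin> DV" "inn x y" "inn x z" "y \<noteq> z" "inn x' y'" "inn x' z'" "x' \<notin> {x, y, z}"
  shows "{x, y, z} \<inter> {x', y', z'} = {}"
  using triangle_inn[OF assms(1-4)] assms(5-7) inn_sym by blast

text \<open>Four chosen vertices color both triangles. The other four corners then force their
  external neighbors, which are distinct and outside both triangles, so the closure has at least ten
  vertices.\<close>

lemma cheap_if_single_link:
  assumes DV: "DV = {}" and T: "inn x y" "inn x z" "y \<noteq> z" and T': "inn x' p" "inn x' q" "p \<noteq> q"
    and xx': "ext x x'" and single: "\<And>u v. u \<in> {y, z} \<Longrightarrow> v \<in> {p, q} \<Longrightarrow> \<not> ext u v"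
  shows cheap
proof -
  have xd: "x \<notin> DV" "x' \<notin> DV" using DV by auto
  obtain ey where ey: "ext y ey" "ey \<notin> {x, y, z}" "\<And>w. adj y w \<longleftrightarrow> w \<in> {x, z, ey}" "\<And>w. inn y w \<longleftrightarrow> w \<in> {x, z}"
    using triangle_nbrs[OF xd(1) T] by metis
  obtain ez where ez: "ext z ez" "ez \<notin> {x, z, y}" "\<And>w. adj z w \<longleftrightarrow> w \<in> {x, y, ez}" "\<And>w. inn z w \<longleftrightarrow> w \<in> {x, y}"
    using triangle_nbrs[OF xd(1) T(2,1) T(3)[symmetric]] by metis
  obtain ep where ep: "ext p ep" "ep \<notin> {x', p, q}" "\<And>w. adj p w \<longleftrightarrow> w \<in> {x', q, ep}" "\<And>w. inn p w \<longleftrightarrow> w \<in> {x', q}"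
    using triangle_nbrs[OF xd(2) T'] by metis
  obtain eq where eq: "ext q eq" "eq \<notin> {x', q, p}" "\<And>w. adj q w \<longleftrightarrow> w \<in> {x', p, eq}" "\<And>w. inn q w \<longleftrightarrow> w \<in> {x', p}"
    using triangle_nbrs[OF xd(2) T'(2,1) T'(3)[symmetric]] by metis
  have x'n: "x' \<notin> {x, y, z}" using xx' T inn_not_ext ext_adj adj_neq by blast
  have xn: "x \<notin> {x', p, q}" using ext_sym[OF xx'] T' inn_not_ext ext_adj adj_neq by blast
  have disj: "{x, y, z} \<inter> {x', p, q} = {}" using triangles_disjoint[OF xd(1) T T'(1,2) x'n] .
  have ne: "x \<noteq> y" "x \<noteq> z" "x' \<noteq> p" "x' \<noteq> q" using T T' inn_adj adj_neq by blast+
  have nx: "adj x w \<longleftrightarrow> w \<in> {y, z, x'}" for w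
    using nbrs_eq[of x y z x' w] inn_adj T ext_adj[OF xx'] x'n by auto
  have nx': "adj x' w \<longleftrightarrow> w \<in> {p, q, x}" for w
    using nbrs_eq[of x' p q x w] inn_adj T' ext_adj[OF ext_sym[OF xx']] xn by auto
  let ?S = "{x, y, x', p}" and ?U = "{x, y, z} \<union> {x', p, q}"
  have "reach ?S (insert z ?S)" by (rule reach_force[of _ _ x]) (use nx in auto)
  then have "reach ?S (insert q (insert z ?S))" by (rule reach_force[of _ _ x']) (use nx' in auto)
  moreover have "insert q (insert z ?S) = ?U" by blast
  moreover have "total ?S" unfolding total_def using T(1) T'(1) inn_adj adj_sym by blast
  moreover have "unit_ok ?U" using unit_ok_two_triangles[OF xd(1) T xd(2) T'] .
  moreover have "?U \<subseteq> V"
    using adj_V[OF inn_adj[OF T(1)]] adj_V[OF inn_adj[OF T'(1)]] adj_V'[OF inn_adj[OF T(1)]]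
      adj_V'[OF inn_adj[OF T'(1)]] adj_V'[OF inn_adj[OF T(2)]] adj_V'[OF inn_adj[OF T'(2)]] by blast
  ultimately have g: "good ?S ?U" unfolding good_def by auto
  have outer: "ey \<notin> {x', p, q}" "ez \<notin> {x', p, q}" "ep \<notin> {x, y, z}" "eq \<notin> {x, y, z}"
    using single ey(1) ez(1) ep(1) eq(1) ext_sym ext_unique[OF xx'] ext_unique[OF ext_sym[OF xx']] ne
    by (metis insert_iff empty_iff)+
  have inj: "e \<noteq> e'" if "ext u e" "ext u' e'" "u \<noteq> u'" for u u' e e'
    using that ext_unique ext_sym by blast
  have oe: "ey \<noteq> ez" "ey \<noteq> ep" "ey \<noteq> eq" "ez \<noteq> ep" "ez \<noteq> eq" "ep \<noteq> eq"
    using inj[OF ey(1) ez(1)] inj[OF ey(1) ep(1)] inj[OF ey(1) eq(1)] inj[OF ez(1) ep(1)]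
      inj[OF ez(1) eq(1)] inj[OF ep(1) eq(1)] T(3) T'(3) disj by blast+
  show cheap
  proof (rule cheap_if_closure[OF g])
    fix Q assume Q: "?U \<subseteq> Q" "Q \<subseteq> V" "stuck Q" "unit_ok Q"
    have "ey \<in> Q" using stuck_inn_closed[OF Q(3), of y ey] Q(1) ey by auto
    moreover have "ez \<in> Q" using stuck_inn_closed[OF Q(3), of z ez] Q(1) ez by auto
    moreover have "ep \<in> Q" using stuck_inn_closed[OF Q(3), of p ep] Q(1) ep by auto
    moreover have "eq \<in> Q" using stuck_inn_closed[OF Q(3), of q eq] Q(1) eq by auto
    ultimately have "?U \<union> {ey, ez, ep, eq} \<subseteq> Q" using Q(1) by blast
    moreover have "card (?U \<union> {ey, ez, ep, eq}) = 10"
    proof -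
      have "card {x, y, z} = 3" "card {x', p, q} = 3" "card {ey, ez, ep, eq} = 4"
        using T(3) T'(3) ne oe by auto
      moreover have "?U \<inter> {ey, ez, ep, eq} = {}" using outer ey(2) ez(2) ep(2) eq(2) by blast
      ultimately show ?thesis using card_Un_disjoint[OF _ _ disj] card_Un_disjoint[of ?U "{ey, ez, ep, eq}"]
        by auto
    qed
    moreover have "finite Q" using Q(2) finite_V finite_subset by blast
    ultimately have "10 \<le> card Q" using card_mono by metis
    moreover have "card ?S \<le> 4" by (simp add: card_insert_if)
    ultimately show "2 * card ?S < card (Q - DV) + card (?U \<inter> DV)" unfolding DV by simp
  qed blast
qed

definition prism_on :: "'a \<Rightarrow> 'a \<Rightarrow> 'a \<Rightarrow> 'a \<Rightarrow> 'a \<Rightarrow> 'a \<Rightarrow> bool" where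
  "prism_on x y z x' y' z' \<longleftrightarrow> V = {x, y, z, x', y', z'} \<and> distinct [x, y, z, x', y', z'] \<and>
     inn x y \<and> inn x z \<and> inn y z \<and> inn x' y' \<and> inn x' z' \<and> inn y' z' \<and>
     ext x x' \<and> ext y y' \<and> ext z z'"

text \<open>With two links, three chosen vertices color both triangles. If \<open>z\<close> and
  \<open>z'\<close> are linked too, the six vertices are closed under adjacency and form the prism.
  Otherwise their external neighbors raise the closure to eight vertices, more than twice
  three.\<close>

lemma double_link:
  assumes DV: "DV = {}" and T: "inn x y" "inn x z" "y \<noteq> z" and T': "inn x' y'" "inn x' z'" "y' \<noteq> z'"
    and xx': "ext x x'" and yy': "ext y y'"
  shows "cheap \<or> prism_on x y z x' y' z' \<and> (\<exists>S. total_forcing S \<and> 2 * card S \<le> card V)"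
proof -
  have xd: "x \<notin> DV" "x' \<notin> DV" using DV by auto
  have i: "inn y z" "inn y' z'" using inn_trans_triangle[OF xd(1) T] inn_trans_triangle[OF xd(2) T'] .
  obtain ez where ez: "ext z ez" "ez \<notin> {x, z, y}" "\<And>w. adj z w \<longleftrightarrow> w \<in> {x, y, ez}" "\<And>w. inn z w \<longleftrightarrow> w \<in> {x, y}"
    using triangle_nbrs[OF xd(1) T(2,1) T(3)[symmetric]] by metis
  obtain ez' where ez': "ext z' ez'" "ez' \<notin> {x', z', y'}" "\<And>w. adj z' w \<longleftrightarrow> w \<in> {x', y', ez'}" "\<And>w. inn z' w \<longleftrightarrow> w \<in> {x', y'}"
    using triangle_nbrs[OF xd(2) T'(2,1) T'(3)[symmetric]] by metis
  have x'n: "x' \<notin> {x, y, z}" using xx' T inn_not_ext ext_adj adj_neq by blast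
  have xn: "x \<notin> {x', y', z'}" using ext_sym[OF xx'] T' inn_not_ext ext_adj adj_neq by blast
  have disj: "{x, y, z} \<inter> {x', y', z'} = {}" using triangles_disjoint[OF xd(1) T T'(1,2) x'n] .
  have ne: "x \<noteq> y" "x \<noteq> z" "x' \<noteq> y'" "x' \<noteq> z'" using T T' inn_adj adj_neq by blast+
  have nx: "adj x w \<longleftrightarrow> w \<in> {y, z, x'}" for w
    using nbrs_eq[of x y z x' w] inn_adj T ext_adj[OF xx'] x'n by auto
  have nx': "adj x' w \<longleftrightarrow> w \<in> {y', z', x}" for w
    using nbrs_eq[of x' y' z' x w] inn_adj T' ext_adj[OF ext_sym[OF xx']] xn by auto
  have ny: "adj y w \<longleftrightarrow> w \<in> {x, z, y'}" for w
    using nbrs_eq[of y x z y' w] inn_adj[OF inn_sym[OF T(1)]] inn_adj[OF i(1)] ext_adj[OF yy'] ne disj by auto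
  have ny': "adj y' w \<longleftrightarrow> w \<in> {x', z', y}" for w
    using nbrs_eq[of y' x' z' y w] inn_adj[OF inn_sym[OF T'(1)]] inn_adj[OF i(2)]
      ext_adj[OF ext_sym[OF yy']] ne disj by auto
  let ?S = "{x, y, x'}" and ?U = "{x, y, z} \<union> {x', y', z'}"
  have "reach ?S (insert z ?S)" by (rule reach_force[of _ _ x]) (use nx in auto)
  then have "reach ?S (insert y' (insert z ?S))" by (rule reach_force[of _ _ y]) (use ny in auto)
  then have "reach ?S (insert z' (insert y' (insert z ?S)))" by (rule reach_force[of _ _ x']) (use nx' in auto)
  moreover have "insert z' (insert y' (insert z ?S)) = ?U" by blast
  moreover have "total ?S" unfolding total_def using T(1) xx' inn_adj ext_adj adj_sym by blast
  moreover have "unit_ok ?U" using unit_ok_two_triangles[OF xd(1) T xd(2) T'] .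
  moreover have UV: "?U \<subseteq> V"
    using adj_V[OF inn_adj[OF T(1)]] adj_V[OF inn_adj[OF T'(1)]] adj_V'[OF inn_adj[OF T(1)]]
      adj_V'[OF inn_adj[OF T'(1)]] adj_V'[OF inn_adj[OF T(2)]] adj_V'[OF inn_adj[OF T'(2)]] by blast
  ultimately have g: "good ?S ?U" unfolding good_def by auto
  have cS: "card ?S \<le> 3" by (simp add: card_insert_if)
  have cU: "card ?U = 6"
  proof -
    have "card {x, y, z} = 3" "card {x', y', z'} = 3" using T(3) T'(3) ne by auto
    then show ?thesis using card_Un_disjoint[OF _ _ disj] by auto
  qed
  show ?thesis
  proof (cases "ez = z'")
    case True
    then have e': "ez' = z" using ext_unique[OF ez'(1)] ext_sym[OF ez(1)] by blast
    have "?U = V"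
      by (rule connected[OF UV]) (use nx ny ez(3) nx' ny' ez'(3) True e' in auto)
    then have "prism_on x y z x' y' z'"
      unfolding prism_on_def using T T' i xx' yy' ez(1) True ne disj by auto
    then show ?thesis using half_if_good[OF g] cS cU by auto
  next
    case False
    then have "ez' \<noteq> z" using ext_unique[OF ez(1)] ext_sym[OF ez'(1)] by blast
    then have outer: "ez \<notin> {x', y', z'}" "ez' \<notin> {x, y, z}"
      using False ext_unique[OF xx'] ext_unique[OF yy'] ext_unique[OF ext_sym[OF xx']]
        ext_unique[OF ext_sym[OF yy']] ext_sym[OF ez(1)] ext_sym[OF ez'(1)] T(3) T'(3) ne by blast+
    have oe: "ez \<noteq> ez'" using ext_unique[OF ext_sym[OF ez(1)]] ext_sym[OF ez'(1)] disj by blast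
    have cheap
    proof (rule cheap_if_closure[OF g])
      fix Q assume Q: "?U \<subseteq> Q" "Q \<subseteq> V" "stuck Q" "unit_ok Q"
      have "ez \<in> Q" using stuck_inn_closed[OF Q(3), of z ez] Q(1) ez by auto
      moreover have "ez' \<in> Q" using stuck_inn_closed[OF Q(3), of z' ez'] Q(1) ez' by auto
      ultimately have "?U \<union> {ez, ez'} \<subseteq> Q" using Q(1) by blast
      moreover have "card (?U \<union> {ez, ez'}) = 8"
      proof -
        have "?U \<inter> {ez, ez'} = {}" using outer ez(2) ez'(2) by blast
        then show ?thesis using cU oe card_Un_disjoint[of ?U "{ez, ez'}"] by auto
      qed
      moreover have "finite Q" using Q(2) finite_V finite_subset by blast
      ultimately have "8 \<le> card Q" using card_mono by metis
      then show "2 * card ?S < card (Q - DV) + card (?U \<inter> DV)" unfolding DV using cS by simp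
    qed blast
    then show ?thesis by blast
  qed
qed

lemma no_diamonds:
  assumes DV: "DV = {}" and V: "V \<noteq> {}"
  shows "cheap \<or> (\<exists>x y z x' y' z'. prism_on x y z x' y' z') \<and> (\<exists>S. total_forcing S \<and> 2 * card S \<le> card V)"
proof -
  obtain x where xV: "x \<in> V" using V by blast
  then obtain y z x' where T: "inn x y" "inn x z" "y \<noteq> z" "ext x x'"
    using triangle_cases[of x] DV by (metis empty_iff)
  have "x' \<in> V" using T ext_adj adj_V' by blast
  then obtain p q where T': "inn x' p" "inn x' q" "p \<noteq> q"
    using triangle_cases[of x'] DV by (metis empty_iff)
  show ?thesis
  proof (cases "\<exists>u\<in>{y, z}. \<exists>v\<in>{p, q}. ext u v")
    case False
    then show ?thesis using cheap_if_single_link[OF DV T(1-3) T' T(4)] by blast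
  next
    case True
    then obtain u v where uv: "u \<in> {y, z}" "v \<in> {p, q}" "ext u v" by blast
    obtain u' where u': "inn x u" "inn x u'" "u \<noteq> u'" using uv T by blast
    obtain v' where v': "inn x' v" "inn x' v'" "v \<noteq> v'" using uv T' by blast
    show ?thesis using double_link[OF DV u' v' T(4) uv(3)] by blast
  qed
qed

text \<open>When \<open>DV\<close> is neither empty nor everything, connectedness gives an edge
  leaving it. This edge is external, and the diamond-meets-triangle case applies.\<close>

lemma upper_bound:
  assumes "V \<noteq> {}"
  shows "\<exists>S. total_forcing S \<and> 2 * card S \<le> card V"
    and "cheap \<or> DV = V \<or> (\<exists>x y z x' y' z'. prism_on x y z x' y' z')"
proof -
  have *: "cheap \<or> (DV = V \<or> (\<exists>x y z x' y' z'. prism_on x y z x' y' z')) \<and>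
      (\<exists>S. total_forcing S \<and> 2 * card S \<le> card V)"
  proof -
    consider "DV = {}" | "DV = V" | "DV \<noteq> {}" "DV \<noteq> V" by blast
    then show ?thesis
    proof cases
      case 1 then show ?thesis using no_diamonds assms by blast
    next
      case 2 then show ?thesis using all_diamonds_half assms by blast
    next
      case 3
      obtain b x where "b \<in> DV" "adj b x" "x \<notin> DV" using connected[OF DV_V 3(1)] 3(2) by blast
      then have "ext x b" using adj_cases inn_DV ext_sym by blast
      then show ?thesis using cheap_if_diamond_meets_triangle \<open>b \<in> DV\<close> \<open>x \<notin> DV\<close> by blast
    qed
  qed
  show "\<exists>S. total_forcing S \<and> 2 * card S \<le> card V"
    using * less_imp_le unfolding cheap_def by blast
  show "cheap \<or> DV = V \<or> (\<exists>x y z x' y' z'. prism_on x y z x' y' z')"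
    using * by blast
qed


section \<open>Lower bounds for total forcing sets\<close>

text \<open>This settles the prism, where half the order is 3. A nonempty total set with at most two
  vertices is an adjacent pair, and each of the two has two uncolored neighbors, so no force is
  possible.\<close>

lemma three_le_card_total_forcing:
  assumes "total_forcing S" "V \<noteq> {}"
  shows "3 \<le> card S"
proof (rule ccontr)
  assume small: "\<not> 3 \<le> card S"
  have S: "S \<subseteq> V" "total S" "reach S V" using assms(1) unfolding total_forcing_def by blast+
  have finS: "finite S" using S(1) finite_V finite_subset by blast
  have nbr: "\<exists>w1 w2. adj u w1 \<and> adj u w2 \<and> w1 \<notin> S \<and> w2 \<notin> S \<and> w1 \<noteq> w2" if u: "u \<in> S" for u
  proof -
    obtain v where v: "v \<in> S" "adj u v" using S(2) u unfolding total_def by blast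
    have "u \<noteq> v" using v adj_neq by blast
    then have "card {u, v} = 2" by simp
    then have Suv: "S = {u, v}" using card_seteq[OF finS, of "{u, v}"] u v(1) small by auto
    have uV: "u \<in> V" using u S(1) by blast
    obtain w1 where w1: "adj u w1" "w1 \<noteq> v" using ex_third_nbr[OF uV, of v v] by metis
    obtain w2 where w2: "adj u w2" "w2 \<noteq> v" "w2 \<noteq> w1" using ex_third_nbr[OF uV, of v w1] by metis
    show ?thesis using w1 w2 Suv adj_neq by blast
  qed
  have no_step: "\<not> fstep S C" for C
  proof
    assume "fstep S C"
    then obtain u v where u: "u \<in> S" "{w. adj u w \<and> w \<notin> S} = {v}" unfolding fstep_def by blast
    obtain w1 w2 where "adj u w1" "adj u w2" "w1 \<notin> S" "w2 \<notin> S" "w1 \<noteq> w2" using nbr[OF u(1)] by blast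
    then have "w1 \<in> {v}" "w2 \<in> {v}" unfolding u(2)[symmetric] by simp_all
    then show False using \<open>w1 \<noteq> w2\<close> by simp
  qed
  have "S = V" using S(3) by (cases rule: converse_rtranclpE) (use no_step in auto)
  then show False using nbr assms(2) adj_V' by blast
qed

text \<open>Outside \<open>c\<close> and \<open>d\<close>, whoever sees one of them sees both, so
  neither can be the first of the two to be forced. Hence one is chosen initially, and its partner
  in the total set is among its neighbors, all inside the diamond.\<close>

lemma total_forcing_dia:
  assumes S: "total_forcing S" and D: "dia a b c d"
  shows "2 \<le> card (S \<inter> {a, b, c, d})"
proof -
  have "S \<inter> {c, d} \<noteq> {}"
  proof
    assume "S \<inter> {c, d} = {}"
    have "reach S C \<Longrightarrow> C \<inter> {c, d} = {}" for C
    proof (induction rule: rtranclp_induct)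
      case (step B C)
      then obtain u v where u: "u \<in> B" "{w. adj u w \<and> w \<notin> B} = {v}" "C = insert v B"
        unfolding fstep_def by blast
      have "v \<notin> {c, d}"
      proof
        assume v: "v \<in> {c, d}"
        have "adj u v" using u(2) by blast
        then have "adj v u" by (rule adj_sym)
        then have "u \<in> {a, b}" using v u(1) step.IH dia_nbrs_c[OF D, of u] dia_nbrs_d[OF D, of u] by blast
        then have "{c, d} \<subseteq> {w. adj u w \<and> w \<notin> B}" using step.IH dia_adj[OF D] by blast
        then show False unfolding u(2) using dia_adj(16)[OF D] by simp
      qed
      then show ?case using step.IH u(3) by blast
    qed fact
    then have "V \<inter> {c, d} = {}" using S unfolding total_forcing_def by blast
    then show False using dia_in_V[OF D] by blast
  qed
  then obtain e where e: "e \<in> S" "e \<in> {c, d}" by blast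
  then obtain f where f: "f \<in> S" "adj e f" using S unfolding total_forcing_def total_def by blast
  have "f \<in> {a, b, c, d}" using e(2) f(2) dia_nbrs_c[OF D, of f] dia_nbrs_d[OF D, of f] by blast
  then have "{e, f} \<subseteq> S \<inter> {a, b, c, d}" using e f by blast
  moreover have "card {e, f} = 2" using f(2) adj_neq by auto
  ultimately show ?thesis using card_mono by (metis finite.emptyI finite.insertI finite_Int)
qed

lemma card_diamonds_le:
  assumes "total_forcing S" "R \<subseteq> DV" "\<And>u w. u \<in> R \<Longrightarrow> inn u w \<Longrightarrow> w \<in> R"
  shows "card R \<le> 2 * card (S \<inter> R)"
proof -
  have "finite R" using assms(2) DV_V finite_V finite_subset by metis
  then show ?thesis using assms(2,3)
  proof (induction "card R" arbitrary: R rule: less_induct)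
    case less
    show ?case
    proof (cases "R = {}")
      case False
      then obtain a b c d v where D: "dia a b c d" "v \<in> {a, b, c, d}" "v \<in> R"
        using less.prems(2) unfolding DV_def by blast
      let ?D = "{a, b, c, d}"
      have sub: "?D \<subseteq> R" using inn_closed_dia[OF D] less.prems(3) by blast
      have "card ?D = 4" using dia_adj[OF D(1)] by auto
      then have c: "card R = card (R - ?D) + 4"
        using card_Diff_subset[OF _ sub] card_mono[OF less.prems(1) sub] by auto
      have IH: "card (R - ?D) \<le> 2 * card (S \<inter> (R - ?D))"
      proof (rule less.hyps)
        fix u w assume u: "u \<in> R - ?D" "inn u w"
        then have "w \<notin> ?D" using dia_inn_closed[OF D(1) _ inn_sym] by blast
        then show "w \<in> R - ?D" using u less.prems(3) by blast
      qed (use c less.prems in auto)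
      have "S \<inter> R = (S \<inter> (R - ?D)) \<union> (S \<inter> ?D)" using sub by blast
      then have "card (S \<inter> R) = card (S \<inter> (R - ?D)) + card (S \<inter> ?D)"
        using card_Un_disjoint[of "S \<inter> (R - ?D)" "S \<inter> ?D"] less.prems(1) by auto
      then show ?thesis using c IH total_forcing_dia[OF assms(1) D(1)] by linarith
    qed simp
  qed
qed

lemma all_diamonds_lower:
  assumes "total_forcing S" "DV = V"
  shows "card V \<le> 2 * card S"
proof -
  have "card V \<le> 2 * card (S \<inter> V)"
    by (rule card_diamonds_le[OF assms(1)]) (use assms(2) inn_adj adj_V' in auto)
  moreover have "S \<inter> V = S" using assms(1) unfolding total_forcing_def by blast
  ultimately show ?thesis by simp
qed

section \<open>The extremal graphs: closed chains of diamonds and the prism\<close>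

text \<open>The labelling of \<open>diamond_necklace\<close>, with the closing edge from
  \<open>(m, Da)\<close> to \<open>(1, Db)\<close> left open.\<close>

definition diamond_chain :: "nat \<Rightarrow> (nat \<times> diamond_vertex \<Rightarrow> 'a) \<Rightarrow> bool" where
  "diamond_chain m f \<longleftrightarrow> inj_on f ({1..m} \<times> UNIV) \<and>
     (\<forall>i\<in>{1..m}. dia (f (i, Da)) (f (i, Db)) (f (i, Dc)) (f (i, Dd))) \<and>
     (\<forall>i\<in>{1..<m}. ext (f (i, Da)) (f (i + 1, Db)))"

lemma UNIV_diamond_vertex: "UNIV = {Da, Db, Dc, Dd}"
  using diamond_vertex.exhaust by blast

lemma card_diamond_blocks: "card ({1..m} \<times> (UNIV :: diamond_vertex set)) = 4 * m"
  unfolding UNIV_diamond_vertex by (simp add: card_cartesian_product)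

text \<open>A chain of maximal length cannot be extended at its last end, so the external neighbor
  of that end lies in the chain. The only end there whose external edge is still unaccounted for is
  \<open>f (1, Db)\<close>.\<close>

lemma diamond_chain_closes:
  assumes DV: "DV = V" and V: "V \<noteq> {}"
  obtains m f where "diamond_chain m f" "2 \<le> m" "ext (f (m, Da)) (f (1, Db))"
proof -
  let ?P = "\<lambda>m. 1 \<le> m \<and> (\<exists>f. diamond_chain m f)"
  obtain a b c d where D0: "dia a b c d" using DV V unfolding DV_def by blast
  define f0 where "f0 p = (case snd p of Da \<Rightarrow> a | Db \<Rightarrow> b | Dc \<Rightarrow> c | Dd \<Rightarrow> d)" for p :: "nat \<times> diamond_vertex"
  have "inj_on f0 ({1..1} \<times> UNIV)"
    unfolding inj_on_def f0_def using dia_adj[OF D0] by (auto split: diamond_vertex.splits)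
  then have "diamond_chain 1 f0" unfolding diamond_chain_def using D0 by (simp add: f0_def)
  then have P1: "?P 1" by blast
  have "\<forall>m. ?P m \<longrightarrow> m \<le> card V"
  proof (intro allI impI)
    fix m assume "?P m"
    then obtain f where f: "diamond_chain m f" by blast
    have "f ` ({1..m} \<times> UNIV) \<subseteq> V"
    proof
      fix v assume "v \<in> f ` ({1..m} \<times> UNIV)"
      then obtain i x where "i \<in> {1..m}" "v = f (i, x)" by blast
      then show "v \<in> V" using f dia_in_V unfolding diamond_chain_def by (cases x) blast+
    qed
    then have "card ({1..m} \<times> (UNIV :: diamond_vertex set)) \<le> card V"
      using f card_inj_on_le[OF _ _ finite_V] unfolding diamond_chain_def by blast
    then show "m \<le> card V" unfolding card_diamond_blocks by simp
  qed
  then obtain m where m: "?P m" "\<And>m'. ?P m' \<Longrightarrow> m' \<le> m"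
    using Nat.ex_has_greatest_nat[of ?P 1 "card V"] P1 by blast
  obtain f where f: "diamond_chain m f" using m(1) by blast
  have inj: "inj_on f ({1..m} \<times> UNIV)"
    and dia: "\<And>i. i \<in> {1..m} \<Longrightarrow> dia (f (i, Da)) (f (i, Db)) (f (i, Dc)) (f (i, Dd))"
    and link: "\<And>i. i \<in> {1..<m} \<Longrightarrow> ext (f (i, Da)) (f (i + 1, Db))"
    using f unfolding diamond_chain_def by blast+
  have injD: "i = j \<and> x = y" if "f (i, x) = f (j, y)" "i \<in> {1..m}" "j \<in> {1..m}" for i j x y
    using inj_onD[OF inj that(1)] that by auto
  have mm: "m \<in> {1..m}" "1 \<in> {1..m}" using m(1) by auto
  obtain v where v: "ext (f (m, Da)) v" using dia_ext[OF dia[OF mm(1)]] by metis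
  have "v \<in> f ` ({1..m} \<times> UNIV)"
  proof (rule ccontr)
    assume nv: "v \<notin> f ` ({1..m} \<times> UNIV)"
    have "v \<in> DV" using DV ext_adj[OF v] adj_V' by blast
    then obtain b' c' d' where D: "dia v b' c' d'" using DV_ext_end v by metis
    \<comment> \<open>The new diamond is entered at \<open>v\<close>, which therefore gets the label
      \<open>Db\<close>; the opposite end becomes the new open end \<open>Da\<close>.\<close>
    define f' where "f' p = (if fst p = m + 1 then (case snd p of Da \<Rightarrow> b' | Db \<Rightarrow> v | Dc \<Rightarrow> c' | Dd \<Rightarrow> d') else f p)" for p
    have new: "f' (m + 1, Da) = b'" "f' (m + 1, Db) = v" "f' (m + 1, Dc) = c'" "f' (m + 1, Dd) = d'"
      by (simp_all add: f'_def)
    have old: "f' (i, x) = f (i, x)" if "i \<in> {1..m}" for i x using that by (simp add: f'_def)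
    have disj: "f (i, x) \<notin> {v, b', c', d'}" if i: "i \<in> {1..m}" for i x
    proof
      assume u: "f (i, x) \<in> {v, b', c', d'}"
      have u': "f (i, x) \<in> {f (i, Da), f (i, Db), f (i, Dc), f (i, Dd)}" by (cases x) auto
      have "{v, b', c', d'} \<subseteq> {f (i, Da), f (i, Db), f (i, Dc), f (i, Dd)}"
        by (rule inn_closed_dia[OF D u u']) (rule dia_inn_closed[OF dia[OF i]])
      then show False using nv i by blast
    qed
    have new_in: "f' (m + 1, x) \<in> {v, b', c', d'}" for x by (cases x) (simp_all add: f'_def)
    have newinj: "x = y" if "f' (m + 1, x) = f' (m + 1, y)" for x y
      using that dia_adj(11-16)[OF D] by (cases x; cases y) (auto simp: f'_def)
    have "inj_on f' ({1..m + 1} \<times> UNIV)"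
    proof (rule inj_onI)
      fix p q assume pq: "p \<in> {1..m + 1} \<times> UNIV" "q \<in> {1..m + 1} \<times> UNIV" "f' p = f' q"
      obtain i x j y where ij: "p = (i, x)" "q = (j, y)" by (cases p, cases q)
      consider "i \<in> {1..m}" "j \<in> {1..m}" | "i \<in> {1..m}" "j = m + 1" | "i = m + 1" "j \<in> {1..m}"
        | "i = m + 1" "j = m + 1" using pq ij by fastforce
      then show "p = q"
      proof cases
        case 1
        then have "f (i, x) = f (j, y)" using pq(3) ij old by simp
        then show ?thesis using injD[OF _ 1] ij by blast
      next
        case 2
        then have eq: "f (i, x) = f' (m + 1, y)" using pq(3) ij old by simp
        have "f (i, x) \<in> {v, b', c', d'}" unfolding eq by (rule new_in)
        then show ?thesis using disj[OF 2(1)] by blast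
      next
        case 3
        then have eq: "f (j, y) = f' (m + 1, x)" using pq(3) ij old by simp
        have "f (j, y) \<in> {v, b', c', d'}" unfolding eq by (rule new_in)
        then show ?thesis using disj[OF 3(2)] by blast
      next
        case 4 then show ?thesis using pq(3) ij newinj by blast
      qed
    qed
    moreover have "dia (f' (i, Da)) (f' (i, Db)) (f' (i, Dc)) (f' (i, Dd))" if "i \<in> {1..m + 1}" for i
    proof (cases "i = m + 1")
      case True
      then show ?thesis using new dia_flip[OF D] by simp
    next
      case False
      then have "i \<in> {1..m}" using that by auto
      then show ?thesis using old dia by simp
    qed
    moreover have "ext (f' (i, Da)) (f' (i + 1, Db))" if i: "i \<in> {1..<m + 1}" for i
    proof (cases "i = m")
      case True
      then show ?thesis using new old[OF mm(1)] v by simp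
    next
      case False
      then have "i \<in> {1..<m}" "i \<in> {1..m}" "i + 1 \<in> {1..m}" using i by auto
      then show ?thesis using old link by metis
    qed
    ultimately have "diamond_chain (m + 1) f'" unfolding diamond_chain_def by blast
    then have "?P (m + 1)" by auto
    then show False using m(2)[of "m + 1"] by simp
  qed
  then obtain j x where jx: "j \<in> {1..m}" "v = f (j, x)" by blast
  note Dj = dia[OF jx(1)]
  have nadj: "\<not> inn v (f (m, Da))" using v ext_sym inn_not_ext by blast
  have adjv: "adj v (f (m, Da))" using ext_adj[OF ext_sym[OF v]] .
  \<comment> \<open>Middle vertices have no external edge, and any other end is already linked
    within the chain; by uniqueness of external edges, injectivity is contradicted.\<close>
  have "x = Db \<and> j = 1"
  proof (cases x)
    case Da
    show ?thesis
    proof (cases "j = m")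
      case True
      then show ?thesis using jx Da adjv adj_irrefl by simp
    next
      case False
      then have j: "j \<in> {1..<m}" using jx by auto
      have "f (m, Da) = f (j + 1, Db)" using ext_unique[OF ext_sym[OF v], of "f (j + 1, Db)"] link[OF j] jx(2) Da by simp
      then show ?thesis using injD[of m Da "j + 1" Db] j by auto
    qed
  next
    case Db
    show ?thesis
    proof (cases "j = 1")
      case False
      then have j: "j - 1 \<in> {1..<m}" using jx by auto
      have "j - 1 + 1 = j" using jx(1) by simp
      then have "ext v (f (j - 1, Da))" using ext_sym[OF link[OF j]] jx(2) Db by simp
      then have "f (m, Da) = f (j - 1, Da)" by (rule ext_unique[OF ext_sym[OF v]])
      then show ?thesis using injD[of m Da "j - 1" Da] j by auto
    qed (use Db in simp)
  next
    case Dc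
    then have "inn v (f (m, Da))"
      using adjv jx dia_nbrs_c[OF Dj, of "f (m, Da)"] dia_inn[OF Dj] by auto
    then show ?thesis using nadj by blast
  next
    case Dd
    then have "inn v (f (m, Da))"
      using adjv jx dia_nbrs_d[OF Dj, of "f (m, Da)"] dia_inn[OF Dj] by auto
    then show ?thesis using nadj by blast
  qed
  then have e: "ext (f (m, Da)) (f (1, Db))" using v jx(2) by blast
  \<comment> \<open>A single diamond cannot close up, since its ends are nonadjacent.\<close>
  have "m \<noteq> 1" using e ext_adj dia_not_adj[OF dia[OF mm(1)]] by auto
  then show ?thesis using that[OF f _ e] m(1) by auto
qed

text \<open>On the closed chain, \<open>inn\<close> corresponds to the arcs inside the diamonds and
  \<open>ext\<close> to the links in both directions.\<close>

lemma all_diamonds_necklace: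
  assumes DV: "DV = V" and V: "V \<noteq> {}"
  obtains k f where "2 \<le> k" "bij_betw f (pverts (diamond_necklace k)) V"
    "\<forall>p\<in>pverts (diamond_necklace k). \<forall>q\<in>pverts (diamond_necklace k).
      adj (f p) (f q) \<longleftrightarrow> (p, q) \<in> parcs (diamond_necklace k)"
proof -
  obtain m f where f: "diamond_chain m f" and m: "2 \<le> m" and e: "ext (f (m, Da)) (f (1, Db))"
    using diamond_chain_closes[OF assms] by metis
  have inj: "inj_on f ({1..m} \<times> UNIV)"
    and dia: "\<And>i. i \<in> {1..m} \<Longrightarrow> dia (f (i, Da)) (f (i, Db)) (f (i, Dc)) (f (i, Dd))"
    and link: "\<And>i. i \<in> {1..<m} \<Longrightarrow> ext (f (i, Da)) (f (i + 1, Db))"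
    using f unfolding diamond_chain_def by blast+
  have injD: "i = j \<and> x = y" if "f (i, x) = f (j, y)" "i \<in> {1..m}" "j \<in> {1..m}" for i j x y
    using inj_onD[OF inj that(1)] that by auto
  have block: "f (i, x) \<in> {f (i, Da), f (i, Db), f (i, Dc), f (i, Dd)}" for i x by (cases x) auto
  \<comment> \<open>Cyclic successor on \<open>{1..m}\<close>, which treats the closing edge like
    the other links.\<close>
  define lk where "lk i = (if i = m then 1 else i + 1)" for i :: nat
  have lk_in: "lk i \<in> {1..m}" if "i \<in> {1..m}" for i using that unfolding lk_def by auto
  have lk_ext: "ext (f (i, Da)) (f (lk i, Db))" if "i \<in> {1..m}" for i
    using that e link[of i] unfolding lk_def by auto
  have lk_surj: "\<exists>j\<in>{1..m}. i = lk j" if "i \<in> {1..m}" for i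
  proof (cases "i = 1")
    case True
    then show ?thesis using m by (intro bexI[of _ m]) (auto simp: lk_def)
  next
    case False
    then show ?thesis using that by (intro bexI[of _ "i - 1"]) (auto simp: lk_def)
  qed
  have inn_iff: "inn (f (i, x)) (f (j, y)) \<longleftrightarrow> i = j \<and> (x, y) \<in> diamond_arcs"
    if ij: "i \<in> {1..m}" "j \<in> {1..m}" for i j x y
  proof
    assume i: "inn (f (i, x)) (f (j, y))"
    have "f (j, y) \<in> {f (i, Da), f (i, Db), f (i, Dc), f (i, Dd)}"
      using dia_inn_closed[OF dia[OF ij(1)] block i] .
    then have eq: "j = i" using injD[of j y i] ij by blast
    moreover have "x \<noteq> y" using i eq inn_adj adj_irrefl by blast
    moreover have "{x, y} \<noteq> {Da, Db}"
      using i eq inn_adj dia_not_adj[OF dia[OF ij(1)]] adj_sym unfolding doubleton_eq_iff by blast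
    ultimately show "i = j \<and> (x, y) \<in> diamond_arcs" unfolding diamond_arcs_def by simp
  next
    assume "i = j \<and> (x, y) \<in> diamond_arcs"
    then have "i = j" "x \<noteq> y" "{x, y} \<noteq> {Da, Db}" unfolding diamond_arcs_def by auto
    then show "inn (f (i, x)) (f (j, y))"
      using dia_inn[OF dia[OF ij(1)]] by (cases x; cases y) auto
  qed
  have no_ext: "\<not> ext (f (i, x)) w" if "i \<in> {1..m}" "x \<in> {Dc, Dd}" for i x w
  proof
    assume ex: "ext (f (i, x)) w"
    note D = dia[OF that(1)]
    have "inn (f (i, x)) w"
      using that(2) ext_adj[OF ex] dia_nbrs_c[OF D, of w] dia_nbrs_d[OF D, of w] dia_inn[OF D] by auto
    then show False using ex inn_not_ext by blast
  qed
  have ext_iff: "ext (f (i, x)) (f (j, y)) \<longleftrightarrow> x = Da \<and> y = Db \<and> j = lk i \<or> x = Db \<and> y = Da \<and> i = lk j"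
    if ij: "i \<in> {1..m}" "j \<in> {1..m}" for i j x y
  proof
    assume ex: "ext (f (i, x)) (f (j, y))"
    show "x = Da \<and> y = Db \<and> j = lk i \<or> x = Db \<and> y = Da \<and> i = lk j"
    proof (cases x)
      case Da
      then have "f (j, y) = f (lk i, Db)" using ext_unique[OF ex] lk_ext[OF ij(1)] by simp
      then show ?thesis using injD[of j y "lk i" Db] ij lk_in Da by blast
    next
      case Db
      obtain i' where i': "i' \<in> {1..m}" "i = lk i'" using lk_surj[OF ij(1)] by blast
      have "ext (f (i, x)) (f (i', Da))" using ext_sym[OF lk_ext[OF i'(1)]] i'(2) Db by simp
      then have "f (j, y) = f (i', Da)" using ext_unique[OF ex] by blast
      then show ?thesis using injD[of j y i' Da] ij i' Db by blast
    qed (use no_ext[OF ij(1)] ex in auto)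
  next
    assume "x = Da \<and> y = Db \<and> j = lk i \<or> x = Db \<and> y = Da \<and> i = lk j"
    then show "ext (f (i, x)) (f (j, y))" using lk_ext ij ext_sym by blast
  qed
  have adj_iff: "adj (f (i, x)) (f (j, y)) \<longleftrightarrow> ((i, x), (j, y)) \<in> parcs (diamond_necklace m)"
    if ij: "i \<in> {1..m}" "j \<in> {1..m}" for i j x y
  proof -
    have links: "((i, x), (j, y)) \<in> necklace_links m \<longleftrightarrow> x = Da \<and> y = Db \<and> j = lk i"
      if "i \<in> {1..m}" for i j x y
      using that unfolding necklace_links_def lk_def by auto
    have "adj (f (i, x)) (f (j, y)) \<longleftrightarrow> inn (f (i, x)) (f (j, y)) \<or> ext (f (i, x)) (f (j, y))"
      using adj_cases inn_adj ext_adj by blast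
    also have "\<dots> \<longleftrightarrow> ((i, x), (j, y)) \<in> parcs (diamond_necklace m)"
      unfolding inn_iff[OF ij] ext_iff[OF ij] diamond_necklace_def using ij links by auto
    finally show ?thesis .
  qed
  have pv: "pverts (diamond_necklace m) = {1..m} \<times> UNIV" by (simp add: diamond_necklace_def)
  let ?I = "f ` ({1..m} \<times> UNIV)"
  \<comment> \<open>Both \<open>inn\<close> and \<open>ext\<close> edges from the chain stay in it,
    so connectedness makes it the whole graph.\<close>
  have "?I = V"
  proof (rule connected)
    show "?I \<subseteq> V"
    proof
      fix v assume "v \<in> ?I"
      then obtain i x where "i \<in> {1..m}" "v = f (i, x)" by blast
      then show "v \<in> V" using dia_in_V[OF dia] block by blast
    qed
    show "?I \<noteq> {}" using m by auto
    fix u w assume "u \<in> ?I" "adj u w"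
    then obtain i x where ix: "i \<in> {1..m}" "u = f (i, x)" by blast
    show "w \<in> ?I"
    proof (cases "inn u w")
      case True
      then have "w \<in> {f (i, Da), f (i, Db), f (i, Dc), f (i, Dd)}"
        using dia_inn_closed[OF dia[OF ix(1)] block] ix(2) by blast
      then show ?thesis using ix(1) by blast
    next
      case False
      then have uw: "ext (f (i, x)) w" using adj_cases \<open>adj u w\<close> ix by blast
      then have "x \<notin> {Dc, Dd}" using no_ext[OF ix(1)] by blast
      then consider "x = Da" | "x = Db" by (cases x) auto
      then show ?thesis
      proof cases
        case 1
        then have "w = f (lk i, Db)" using ext_unique[OF uw] lk_ext[OF ix(1)] by blast
        then show ?thesis using lk_in[OF ix(1)] by blast
      next
        case 2
        obtain i' where i': "i' \<in> {1..m}" "i = lk i'" using lk_surj[OF ix(1)] by blast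
        have "w = f (i', Da)" using ext_unique[OF uw] ext_sym[OF lk_ext[OF i'(1)]] i'(2) 2 by blast
        then show ?thesis using i'(1) by blast
      qed
    qed
  qed
  then have "bij_betw f (pverts (diamond_necklace m)) V" unfolding pv bij_betw_def using inj by blast
  moreover have "\<forall>p\<in>pverts (diamond_necklace m). \<forall>q\<in>pverts (diamond_necklace m).
      adj (f p) (f q) \<longleftrightarrow> (p, q) \<in> parcs (diamond_necklace m)"
    unfolding pv using adj_iff by auto
  ultimately show ?thesis using that[OF m] by blast
qed

lemma prism_on_iso:
  assumes P: "prism_on x y z x' y' z'"
  obtains f where "bij_betw f (pverts prism) V"
    "\<forall>p\<in>pverts prism. \<forall>q\<in>pverts prism. adj (f p) (f q) \<longleftrightarrow> (p, q) \<in> parcs prism"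
proof -
  have i: "inn x y" "inn x z" "inn y z" "inn x' y'" "inn x' z'" "inn y' z'"
    and e: "ext x x'" "ext y y'" "ext z z'" and ne: "distinct [x, y, z, x', y', z']"
    and V: "V = {x, y, z, x', y', z'}"
    using P unfolding prism_on_def by auto
  have a: "adj x y" "adj x z" "adj y z" "adj y x" "adj z x" "adj z y"
    "adj x' y'" "adj x' z'" "adj y' z'" "adj y' x'" "adj z' x'" "adj z' y'"
    "adj x x'" "adj y y'" "adj z z'" "adj x' x" "adj y' y" "adj z' z"
    using i e inn_adj ext_adj adj_sym by blast+
  have nb: "adj x w \<longleftrightarrow> w \<in> {y, z, x'}" "adj y w \<longleftrightarrow> w \<in> {x, z, y'}" "adj z w \<longleftrightarrow> w \<in> {x, y, z'}"
    "adj x' w \<longleftrightarrow> w \<in> {y', z', x}" "adj y' w \<longleftrightarrow> w \<in> {x', z', y}" "adj z' w \<longleftrightarrow> w \<in> {x', y', z}" for w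
    by (rule nbrs_eq; use a ne in auto)+
  define f where "f p = (if snd p = 0 then (if fst p = 0 then x else if fst p = 1 then y else z)
    else (if fst p = 0 then x' else if fst p = 1 then y' else z'))" for p :: "nat \<times> nat"
  have pv: "pverts prism = {0, 1, 2} \<times> {0, 1}"
    by (simp add: prism_def cartesian_product_def complete_on_def)
  have pv6: "pverts prism = {(0, 0), (1, 0), (2, 0), (0, 1), (1, 1), (2, 1)}" unfolding pv by auto
  have f6: "f (0, 0) = x" "f (1, 0) = y" "f (2, 0) = z" "f (0, 1) = x'" "f (1, 1) = y'" "f (2, 1) = z'"
    by (simp_all add: f_def)
  have parc: "((u, s), (v, t)) \<in> parcs prism \<longleftrightarrow>
      u = v \<and> u \<in> {0, 1, 2} \<and> s \<in> {0, 1} \<and> t \<in> {0, 1} \<and> s \<noteq> t \<or>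
      s = t \<and> s \<in> {0, 1} \<and> u \<in> {0, 1, 2} \<and> v \<in> {0, 1, 2} \<and> u \<noteq> v" for u s v t
    unfolding prism_def cartesian_product_def complete_on_def by auto
  have dist: "x \<noteq> y" "x \<noteq> z" "x \<noteq> x'" "x \<noteq> y'" "x \<noteq> z'" "y \<noteq> z" "y \<noteq> x'" "y \<noteq> y'" "y \<noteq> z'"
    "z \<noteq> x'" "z \<noteq> y'" "z \<noteq> z'" "x' \<noteq> y'" "x' \<noteq> z'" "y' \<noteq> z'"
    using ne by simp_all
  note dist' = dist dist[symmetric]
  have "inj_on f (pverts prism)" unfolding pv6 inj_on_def ball_simps f6 using dist' by simp
  moreover have "f ` pverts prism = V" unfolding pv6 V image_insert f6 by simp
  ultimately have "bij_betw f (pverts prism) V" unfolding bij_betw_def by blast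
  moreover have "\<forall>p\<in>pverts prism. \<forall>q\<in>pverts prism. adj (f p) (f q) \<longleftrightarrow> (p, q) \<in> parcs prism"
    unfolding pv6 ball_simps f6 nb parc using dist' by simp
  ultimately show ?thesis using that by blast
qed

end


section \<open>Transfer to digraphs and their isomorphisms\<close>

lemma (in graph) card_nbrs_eq_out_degree:
  "card {w. v \<rightarrow>\<^bsub>G\<^esub> w} = out_degree G v"
proof -
  have "inj_on (head G) (out_arcs G v)"
    by (rule inj_onI) (use no_multi_arcs in \<open>auto simp: arc_to_ends_def\<close>)
  moreover have "head G ` out_arcs G v = {w. v \<rightarrow>\<^bsub>G\<^esub> w}"
    by (auto simp: arcs_ends_def arc_to_ends_def)
  ultimately show ?thesis unfolding out_degree_def by (metis card_image)
qed

lemma dominates_induce_iff: "u \<rightarrow>\<^bsub>G \<restriction> A\<^esub> w \<longleftrightarrow> u \<rightarrow>\<^bsub>G\<^esub> w \<and> u \<in> A \<and> w \<in> A"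
  by (auto simp: arcs_ends_def arc_to_ends_def)

lemma (in graph) cubic_claw_free_dominates:
  assumes con: "connected G" and cf: "claw_free G" and cub: "cubic G" and nK: "\<not> K\<^bsub>4\<^esub> G"
  shows "cubic_claw_free (verts G) (\<lambda>u v. u \<rightarrow>\<^bsub>G\<^esub> v)"
proof
  let ?adj = "\<lambda>u v. u \<rightarrow>\<^bsub>G\<^esub> v"
  have sym: "?adj v u" if "?adj u v" for u v using that by (rule graph_symmetric)
  have vert: "u \<in> verts G" "v \<in> verts G" if "?adj u v" for u v
    using that adj_in_verts by blast+
  have irr: "\<not> ?adj v v" for v using adj_not_same by blast
  show "finite (verts G)" by simp
  show "u \<in> verts G" if "?adj u v" for u v using vert that by blast
  show "?adj v u" if "?adj u v" for u v using sym that .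
  show "\<not> ?adj v v" for v using irr .
  show deg: "card {w. ?adj v w} = 3" if "v \<in> verts G" for v
    using that cub card_nbrs_eq_out_degree unfolding cubic_def by simp
  show conn: "U = verts G"
    if U: "U \<subseteq> verts G" "U \<noteq> {}" and closed: "\<And>u v. u \<in> U \<Longrightarrow> ?adj u v \<Longrightarrow> v \<in> U" for U
  proof -
    obtain u where u: "u \<in> U" using U(2) by blast
    have "w \<in> U" if w: "w \<in> verts G" for w
    proof -
      have "strongly_connected G" using symmetric_connected_imp_strongly_connected[OF sym_arcs con] .
      then have "u \<rightarrow>\<^sup>*\<^bsub>G\<^esub> w" using u U(1) w unfolding strongly_connected_def by blast
      then show ?thesis
        by (induction rule: reachable_induct) (use u closed in auto)
    qed
    then show ?thesis using U(1) by blast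
  qed
  show "?adj x y \<or> ?adj y z \<or> ?adj x z"
    if a: "?adj v x" "?adj v y" "?adj v z" and ne: "x \<noteq> y" "y \<noteq> z" "x \<noteq> z" for v x y z
  proof (rule ccontr)
    assume n: "\<not> ?thesis"
    let ?A = "{v, x, y, z}"
    have A: "?A \<subseteq> verts G" using a vert by blast
    have graph_A: "graph (G \<restriction> ?A)"
      using digraphI_induced[OF induced_induce[OF A]] induced_graph_imp_graph[OF induced_induce[OF A]]
      by (simp add: graph_def pseudo_graph_def digraph_def)
    have "v \<notin> {x, y, z}" using a irr by auto
    have "arcs_ends (G \<restriction> ?A) = {v} \<times> {x, y, z} \<union> {x, y, z} \<times> {v}"
    proof -
      have h: "(p, q) \<in> arcs_ends (G \<restriction> ?A) \<longleftrightarrow> (p, q) \<in> {v} \<times> {x, y, z} \<union> {x, y, z} \<times> {v}" for p q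
        unfolding dominates_induce_iff using a n irr sym by blast
      show ?thesis by (intro equalityI subrelI) (simp_all only: h)
    qed
    moreover have "verts (G \<restriction> ?A) = {v} \<union> {x, y, z}" "{v} \<inter> {x, y, z} = {}"
      using \<open>v \<notin> {x, y, z}\<close> by auto
    moreover have "card {v} = 1" "card {x, y, z} = 3" using ne by auto
    ultimately have "K\<^bsub>1,3\<^esub> (G \<restriction> ?A)"
      unfolding complete_bipartite_digraph_def using graph_A by blast
    then show False using cf induced_induce[OF A] unfolding claw_free_def by blast
  qed
  show "\<not> ?adj c d"
    if a: "?adj a b" "?adj a c" "?adj a d" "?adj b c" "?adj b d" for a b c d
  proof
    assume cd: "?adj c d"
    have ne: "a \<noteq> b" "a \<noteq> c" "a \<noteq> d" "b \<noteq> c" "b \<noteq> d" "c \<noteq> d" using a cd irr by auto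
    have A: "{a, b, c, d} \<subseteq> verts G" using a vert by blast
    have nb: "w \<in> {p, q, r}" if "?adj v p" "?adj v q" "?adj v r" "card {p, q, r} = 3" "?adj v w" for v p q r w
    proof -
      have "card {w. ?adj v w} = 3" using deg vert that by blast
      moreover from this have "finite {w. ?adj v w}" by (metis card.infinite zero_neq_numeral)
      ultimately have "{p, q, r} = {w. ?adj v w}" using that by (intro card_subset_eq) auto
      then show ?thesis using that(5) by blast
    qed
    \<comment> \<open>Within a K4 each vertex already has three neighbors, so nothing leaves it and
      connectedness makes it all of \<open>G\<close>.\<close>
    have closed: "w \<in> {a, b, c, d}" if "u \<in> {a, b, c, d}" "?adj u w" for u w
      using that nb[of a b c d w] nb[of b a c d w] nb[of c a b d w] nb[of d a b c w] a cd sym ne by auto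
    have V: "{a, b, c, d} = verts G" by (rule conn[OF A]) (use closed in auto)
    have all: "?adj u w" if "u \<in> {a, b, c, d}" "w \<in> {a, b, c, d}" "u \<noteq> w" for u w
      using that a cd a[THEN sym] sym[OF cd] by auto
    have "arcs_ends G = {(u, w). (u, w) \<in> verts G \<times> verts G \<and> u \<noteq> w}"
    proof -
      have h: "(u, w) \<in> arcs_ends G \<longleftrightarrow> (u, w) \<in> {(u, w). (u, w) \<in> verts G \<times> verts G \<and> u \<noteq> w}" for u w
        using all[unfolded V] vert irr by blast
      show ?thesis by (intro equalityI subrelI) (simp_all only: h)
    qed
    moreover have "card (verts G) = 4" unfolding V[symmetric] using ne by simp
    ultimately show False using nK graph_axioms unfolding complete_digraph_def by blast
  qed
qed

text \<open>The isomorphism has to map \<open>G\<close> onto \<open>H\<close>, hence the inverse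
  \<open>g\<close> of \<open>f\<close>. Each arc goes to the pair of images of its ends, which is
  injective as there are no parallel arcs.\<close>

lemma (in graph) digraph_isoI:
  assumes bij: "bij_betw f (pverts H) (verts G)"
    and adj: "\<And>p q. p \<in> pverts H \<Longrightarrow> q \<in> pverts H \<Longrightarrow> f p \<rightarrow>\<^bsub>G\<^esub> f q \<longleftrightarrow> (p, q) \<in> parcs H"
    and sub: "parcs H \<subseteq> pverts H \<times> pverts H"
  shows "digraph_iso G (with_proj H)"
proof -
  define g where "g = the_inv_into (pverts H) f"
  have inj: "inj_on f (pverts H)" and img: "f ` pverts H = verts G" using bij unfolding bij_betw_def by auto
  have gf: "g (f p) = p" if "p \<in> pverts H" for p using that the_inv_into_f_f[OF inj] g_def by simp
  have gv: "g v \<in> pverts H" "f (g v) = v" if "v \<in> verts G" for v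
    using that gf unfolding img[symmetric] by auto
  have ginj: "inj_on g (verts G)" using gv by (metis inj_onI)
  define hom where "hom = \<lparr>iso_verts = g, iso_arcs = (\<lambda>e. (g (tail G e), g (head G e))), iso_head = snd, iso_tail = fst\<rparr>"
  have "inj_on (\<lambda>e. (g (tail G e), g (head G e))) (arcs G)"
  proof (rule inj_onI)
    fix e e' assume e: "e \<in> arcs G" "e' \<in> arcs G"
      and "(g (tail G e), g (head G e)) = (g (tail G e'), g (head G e'))"
    then have "tail G e = tail G e'" "head G e = head G e'" using inj_onD[OF ginj] by auto
    then show "e = e'" using no_multi_arcs[OF e] by (auto simp: arc_to_ends_def)
  qed
  then have "digraph_isomorphism hom"
    unfolding digraph_isomorphism_def hom_def using ginj wf_digraph_axioms by auto
  moreover have "with_proj H = app_iso hom G"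
  proof (rule pre_digraph.equality)
    show "verts (with_proj H) = verts (app_iso hom G)"
      unfolding hom_def using gv gf img by auto (metis gf image_eqI)
    have "(\<lambda>e. (g (tail G e), g (head G e))) ` arcs G = parcs H"
    proof (intro equalityI subsetI)
      fix p assume "p \<in> (\<lambda>e. (g (tail G e), g (head G e))) ` arcs G"
      then obtain e where e: "e \<in> arcs G" "p = (g (tail G e), g (head G e))" by blast
      then have "tail G e \<rightarrow>\<^bsub>G\<^esub> head G e" by (auto simp: arcs_ends_def arc_to_ends_def)
      then show "p \<in> parcs H" using adj[of "g (tail G e)" "g (head G e)"] gv e by auto
    next
      fix p assume p: "p \<in> parcs H"
      obtain s t where st: "p = (s, t)" by (cases p)
      have mem: "s \<in> pverts H" "t \<in> pverts H" using sub p st by auto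
      then have "f s \<rightarrow>\<^bsub>G\<^esub> f t" using adj p st by blast
      then obtain e where "e \<in> arcs G" "tail G e = f s" "head G e = f t"
        by (auto simp: arcs_ends_def arc_to_ends_def)
      then show "p \<in> (\<lambda>e. (g (tail G e), g (head G e))) ` arcs G"
        using gf mem st by (intro image_eqI[of _ _ e]) auto
    qed
    then show "arcs (with_proj H) = arcs (app_iso hom G)" unfolding hom_def by simp
  qed (simp_all add: hom_def)
  ultimately show ?thesis unfolding digraph_iso_def by blast
qed

text \<open>An arc of \<open>H\<close> between two images comes from an arc of \<open>G\<close>,
  whose ends are identified by injectivity on vertices.\<close>

lemma (in graph) digraph_isoE:
  assumes "digraph_iso G (with_proj H)"
  obtains g where "bij_betw g (verts G) (pverts H)"
    "\<And>u v. u \<in> verts G \<Longrightarrow> v \<in> verts G \<Longrightarrow> (g u, g v) \<in> parcs H \<Longrightarrow> u \<rightarrow>\<^bsub>G\<^esub> v"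
proof -
  obtain hom where hom: "digraph_isomorphism hom" and H: "with_proj H = app_iso hom G"
    using assms unfolding digraph_iso_def by blast
  let ?g = "iso_verts hom"
  have inj: "inj_on ?g (verts G)" using hom unfolding digraph_isomorphism_def by blast
  have "verts (with_proj H) = ?g ` verts G" unfolding H by simp
  then have bij: "bij_betw ?g (verts G) (pverts H)" using inj unfolding bij_betw_def by simp
  have "u \<rightarrow>\<^bsub>G\<^esub> v" if uv: "u \<in> verts G" "v \<in> verts G" "(?g u, ?g v) \<in> parcs H" for u v
  proof -
    have "arcs (with_proj H) = iso_arcs hom ` arcs G" unfolding H by simp
    then obtain e where e: "e \<in> arcs G" "(?g u, ?g v) = iso_arcs hom e" using uv(3) by auto
    have "tail (with_proj H) = iso_tail hom" "head (with_proj H) = iso_head hom" unfolding H by simp_all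
    then have "iso_tail hom = fst" "iso_head hom = snd" by simp_all
    then have "?g (tail G e) = ?g u" "?g (head G e) = ?g v"
      using iso_verts_tail[OF hom e(1)] iso_verts_head[OF hom e(1)] e(2)[symmetric] by simp_all
    then have "tail G e = u" "head G e = v" using inj_onD[OF inj] uv e(1) by auto
    then show ?thesis using e(1) by (auto simp: arcs_ends_def arc_to_ends_def)
  qed
  then show ?thesis using that[OF bij] by blast
qed

theorem theorem2:
  fixes G :: "('a, 'b) pre_digraph" and n :: nat
  assumes "graph G"
    and "connected G"
    and "claw_free G"
    and "cubic G"
    and "\<not> K\<^bsub>4\<^esub> G"
    and "n = card (verts G)"
  shows "real (total_forcing_number G) \<le> 1 / 2 * real n \<and>
    (real (total_forcing_number G) = 1 / 2 * real n \<longleftrightarrow>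
      in_N_cubic G \<or> digraph_iso G (with_proj prism))"
proof -
  interpret graph G by fact
  let ?adj = "\<lambda>u v. u \<rightarrow>\<^bsub>G\<^esub> v"
  interpret C: cubic_claw_free "verts G" ?adj
    using cubic_claw_free_dominates assms(2-5) by blast
  have ne: "verts G \<noteq> {}"
    using assms(2) unfolding Digraph_Component.connected_def strongly_connected_def by simp
  have step: "force_step G = C.fstep"
    unfolding force_step_def C.fstep_def by (intro ext) simp
  have tf: "total_forcing_set G S \<longleftrightarrow> C.total_forcing S" for S
    unfolding total_forcing_set_def forcing_set_def C.total_forcing_def C.total_def step dominates_induce_iff
    by blast
  let ?F = "total_forcing_number G"
  have upper: "?F \<le> card S" if "C.total_forcing S" for S
    unfolding total_forcing_number_def tf using that by (intro Least_le) blast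
  obtain S0 where S0: "C.total_forcing S0" "2 * card S0 \<le> card (verts G)"
    using C.upper_bound(1)[OF ne] by blast
  have "\<exists>S. C.total_forcing S \<and> card S = ?F"
    unfolding total_forcing_number_def tf by (rule LeastI_ex) (use S0 in blast)
  then obtain S where S: "C.total_forcing S" "card S = ?F" by blast
  have le: "2 * ?F \<le> n" using upper[OF S0(1)] S0(2) assms(6) by linarith
  have fwd: "in_N_cubic G \<or> digraph_iso G (with_proj prism)" if eq: "2 * ?F = n"
  proof -
    \<comment> \<open>A cheap set would be a total forcing set smaller than the minimum.\<close>
    have "\<not> C.cheap" unfolding C.cheap_def using upper eq assms(6) by (metis leD mult_le_mono2)
    then consider "C.DV = verts G" | x y z x' y' z' where "C.prism_on x y z x' y' z'"
      using C.upper_bound(2)[OF ne] by blast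
    then show ?thesis
    proof cases
      case 1
      obtain k f where kf: "2 \<le> k" "bij_betw f (pverts (diamond_necklace k)) (verts G)"
        "\<forall>p\<in>pverts (diamond_necklace k). \<forall>q\<in>pverts (diamond_necklace k).
          ?adj (f p) (f q) \<longleftrightarrow> (p, q) \<in> parcs (diamond_necklace k)"
        using C.all_diamonds_necklace[OF 1 ne] by metis
      interpret N: pair_graph "diamond_necklace k" by (rule pair_graph_diamond_necklace[OF kf(1)])
      have "parcs (diamond_necklace k) \<subseteq> pverts (diamond_necklace k) \<times> pverts (diamond_necklace k)"
        using N.in_arcsD1 N.in_arcsD2 by auto
      then have "digraph_iso G (with_proj (diamond_necklace k))"
        using digraph_isoI[OF kf(2)] kf(3) by blast
      then show ?thesis unfolding in_N_cubic_def using kf(1) by blast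
    next
      case 2
      obtain f where f: "bij_betw f (pverts prism) (verts G)"
        "\<forall>p\<in>pverts prism. \<forall>q\<in>pverts prism. ?adj (f p) (f q) \<longleftrightarrow> (p, q) \<in> parcs prism"
        using C.prism_on_iso[OF 2] by metis
      interpret N: pair_graph prism by (rule pair_graph_prism)
      have "parcs prism \<subseteq> pverts prism \<times> pverts prism" using N.in_arcsD1 N.in_arcsD2 by auto
      then show ?thesis using digraph_isoI[OF f(1)] f(2) by blast
    qed
  qed
  have bwd: "2 * ?F = n" if "in_N_cubic G \<or> digraph_iso G (with_proj prism)"
    using that
  proof
    assume "in_N_cubic G"
    then obtain k where k: "2 \<le> k" "digraph_iso G (with_proj (diamond_necklace k))"
      unfolding in_N_cubic_def by blast
    let ?N = "diamond_necklace k"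
    obtain g where g: "bij_betw g (verts G) (pverts ?N)"
      "\<And>u v. u \<in> verts G \<Longrightarrow> v \<in> verts G \<Longrightarrow> (g u, g v) \<in> parcs ?N \<Longrightarrow> ?adj u v"
      using digraph_isoE[OF k(2)] by metis
    \<comment> \<open>Each diamond of the necklace pulls back to a diamond of \<open>G\<close>, so
      every vertex is in one and the count of two chosen vertices per diamond gives the reverse
      bound.\<close>
    have "verts G \<subseteq> C.DV"
    proof
      fix v assume v: "v \<in> verts G"
      then have "g v \<in> pverts ?N" using g(1) bij_betwE by metis
      then obtain i x where ix: "g v = (i, x)" "i \<in> {1..k}" by (auto simp: diamond_necklace_def)
      have "\<exists>u\<in>verts G. g u = (i, y)" for y
      proof -
        have "(i, y) \<in> g ` verts G"
          using g(1) ix(2) unfolding bij_betw_def by (simp add: diamond_necklace_def)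
        then show ?thesis by force
      qed
      then obtain h where h: "\<And>y. h y \<in> verts G" "\<And>y. g (h y) = (i, y)" by metis
      have hadj: "?adj (h y) (h y')" if "(y, y') \<in> diamond_arcs" for y y'
        by (rule g(2)) (use h that ix(2) in \<open>auto simp: diamond_necklace_def\<close>)
      have "h Da \<noteq> h Db" using h(2) by (metis diamond_vertex.distinct(1) prod.inject)
      then have "C.dia (h Da) (h Db) (h Dc) (h Dd)"
        unfolding C.dia_def using hadj by (auto simp: diamond_arcs_def)
      moreover have "v = h x"
        using inj_onD[OF bij_betw_imp_inj_on[OF g(1)]] h v ix(1) by metis
      then have "v \<in> {h Da, h Db, h Dc, h Dd}" by (cases x) auto
      ultimately show "v \<in> C.DV" unfolding C.DV_def by blast
    qed
    then have "C.DV = verts G" using C.DV_V by blast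
    then have "n \<le> 2 * ?F" using C.all_diamonds_lower[OF S(1)] S(2) assms(6) by simp
    then show ?thesis using le by simp
  next
    assume "digraph_iso G (with_proj prism)"
    then obtain g where "bij_betw g (verts G) (pverts prism)" using digraph_isoE by metis
    then have "n = card (pverts prism)" using assms(6) bij_betw_same_card by metis
    moreover have "pverts prism = {0, 1, 2} \<times> {0, 1}"
      by (simp add: prism_def cartesian_product_def complete_on_def)
    ultimately have "n = 6" by (simp add: card_cartesian_product)
    then show ?thesis using C.three_le_card_total_forcing[OF S(1) ne] S(2) le by simp
  qed
  have "real ?F = 1 / 2 * real n \<longleftrightarrow> 2 * ?F = n" by linarith
  then show ?thesis using le fwd bwd by auto
qed

end
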